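(* Let $h:\mathbb{B}^4\times\mathbb{B}^k\to\mathbb{R}$, $(\mathbf{x},z_1,\dots,z_k)\mapsto h(\mathbf{x},\mathbf{z})$, be any function in $\mathcal{F}^2$, possibly containing bilinear terms $z_iz_j$ between auxiliary variables. Then there exists $h':\mathbb{B}^4\times\mathbb{B}^2\to\mathbb{R}$ in $\mathcal{F}^2$, with two auxiliary variables $z_{j1},z_{j2}$, such that $\min_{z_{j1},z_{j2}\in\mathbb{B}}h'(\mathbf{x},z_{j1},z_{j2})=\min_{\mathbf{z}\in\mathbb{B}^k}h(\mathbf{x},\mathbf{z})$ for all $\mathbf{x}\in\mathbb{B}^4$.
   Context: $\mathbb{B}=\{0,1\}$. $\mathcal{F}^2$ denotes the submodular pseudo-Boolean functions of order at most $2$, i.e. multilinear polynomials of degree $\le2$ in all their variables whose bilinear coefficients are all non-positive. "Transformed" means equality of the minima over the auxiliary variables for every $\mathbf{x}$. The paper works throughout this section with four original variables $\mathbf{x}=(x_1,\dots,x_4)$. *)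

theory Defs
  imports Complex_Main
begin

text \<open>
  A point of \<open>{0,1}^n\<close> is a Boolean list of length \<open>n\<close>, entered into polynomials through
  \<open>of_bool\<close>. The product \<open>{0,1}^m \<times> {0,1}^k\<close> is identified with \<open>{0,1}^(m + k)\<close> via
  concatenation \<open>x @ z\<close>.
\<close>

definition bcube :: "nat \<Rightarrow> bool list set" where
  "bcube n = {v. length v = n}"

lemma finite_bcube: "finite (bcube n)"
  using finite_lists_length_eq[of "UNIV :: bool set" n] by (simp add: bcube_def)

lemma bcube_nonempty: "bcube n \<noteq> {}"
  using Ex_list_of_length[of n] by (auto simp: bcube_def)

definition quad_poly ::
  "nat \<Rightarrow> real \<Rightarrow> (nat \<Rightarrow> real) \<Rightarrow> (nat \<Rightarrow> nat \<Rightarrow> real) \<Rightarrow> bool list \<Rightarrow> real" where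
  "quad_poly n c a b v =
     c + (\<Sum>i<n. a i * of_bool (v ! i))
       + (\<Sum>j<n. \<Sum>i<j. b i j * of_bool (v ! i) * of_bool (v ! j))"

text \<open>
  The class \<open>F\<^sup>2\<close> of functions of \<open>n\<close> Boolean variables. Only values on \<open>bcube n\<close> matter.
\<close>

definition submodular_quadratic :: "nat \<Rightarrow> (bool list \<Rightarrow> real) \<Rightarrow> bool" where
  "submodular_quadratic n f \<longleftrightarrow>
     (\<exists>c a b. (\<forall>j<n. \<forall>i<j. b i j \<le> 0) \<and> (\<forall>v\<in>bcube n. f v = quad_poly n c a b v))"

end

theory Submission
  imports Defs
begin

text \<open>
  Write \<open>- f\<close>, where \<open>f x = MIN z. h (x @ z)\<close>, as a multilinear polynomial in
  \<open>x1, ..., x4\<close>. Second differences of \<open>- f\<close> are nonnegative, and a five-ary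
  weight-preserving operation that does not decrease inner products gives six further
  inequalities that every such \<open>f\<close> satisfies although not every submodular function does.
  These linear inequalities already force two auxiliary variables to suffice: the first
  auxiliary variable is switched on at the points of weight at least 2, the second one at
  the points of weight at least 3. The only exceptions are gaps, that is, points of weight
  2, at most two of them, at which the first variable must stay off. The coefficients come
  from a potential \<open>s1, ..., s4\<close> on the complete graph on four vertices whose edge sums
  \<open>si + sj\<close> lie in prescribed intervals.
\<close>

section \<open>Potentials on the complete graph with four vertices\<close>

lemma interval_sum_attained:
  fixes v :: real
  assumes "a \<le> b" "c \<le> d" "a + c \<le> v" "v \<le> b + d"
  obtains y z where "a \<le> y" "y \<le> b" "c \<le> z" "z \<le> d" "y + z = v"
proof
  show "a \<le> max a (v - d)" "max a (v - d) \<le> b" "c \<le> v - max a (v - d)"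
    "v - max a (v - d) \<le> d" "max a (v - d) + (v - max a (v - d)) = v"
    using assms by auto
qed

text \<open>
  The inequalities \<open>tri\<close> and \<open>cap\<close> rule out the alternating closed walks that obstruct a
  potential. The sum of all \<open>si\<close> is fixed as the largest matching weight \<open>A12 + A34\<close>; at
  most one loop constraint \<open>- ci \<le> 2 * si\<close> can fail at a time, since \<open>Aij \<ge> - ci, - cj\<close>.
\<close>

lemma tight_matching_potential:
  fixes A12 A13 A14 A23 A24 A34 r12 r13 r14 r23 r24 r34 c1 c2 c3 c4 :: real
  assumes Ar: "A12 \<le> r12" "A13 \<le> r13" "A14 \<le> r14" "A23 \<le> r23" "A24 \<le> r24" "A34 \<le> r34"
    and Ac: "A12 \<ge> - c1" "A12 \<ge> - c2" "A13 \<ge> - c1" "A13 \<ge> - c3" "A14 \<ge> - c1" "A14 \<ge> - c4"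
      "A23 \<ge> - c2" "A23 \<ge> - c3" "A24 \<ge> - c2" "A24 \<ge> - c4" "A34 \<ge> - c3" "A34 \<ge> - c4"
    and big: "A13 + A24 \<le> A12 + A34" "A14 + A23 \<le> A12 + A34"
    and cap: "A12 + A34 \<le> r13 + r24" "A12 + A34 \<le> r14 + r23"
    and tri: "A23 \<le> A12 + A13 + c1" "A24 \<le> A12 + A14 + c1" "A34 \<le> A13 + A14 + c1"
      "A13 \<le> A12 + A23 + c2" "A14 \<le> A12 + A24 + c2" "A34 \<le> A23 + A24 + c2"
      "A12 \<le> A13 + A23 + c3" "A14 \<le> A13 + A34 + c3" "A24 \<le> A23 + A34 + c3"
      "A12 \<le> A14 + A24 + c4" "A13 \<le> A14 + A34 + c4" "A23 \<le> A24 + A34 + c4"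
  shows "\<exists>s1 s2 s3 s4. A12 \<le> s1 + s2 \<and> s1 + s2 \<le> r12 \<and> A13 \<le> s1 + s3 \<and> s1 + s3 \<le> r13 \<and>
    A14 \<le> s1 + s4 \<and> s1 + s4 \<le> r14 \<and> A23 \<le> s2 + s3 \<and> s2 + s3 \<le> r23 \<and>
    A24 \<le> s2 + s4 \<and> s2 + s4 \<le> r24 \<and> A34 \<le> s3 + s4 \<and> s3 + s4 \<le> r34 \<and>
    - c1 \<le> 2 * s1 \<and> - c2 \<le> 2 * s2 \<and> - c3 \<le> 2 * s3 \<and> - c4 \<le> 2 * s4"
proof -
  \<comment> \<open>With \<open>s1 + s2 = A12\<close> and \<open>s3 + s4 = A34\<close> fixed, the
    unknowns left are \<open>y = s1 + s3\<close> and \<open>z = s1 + s4\<close>, since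
    \<open>s2 + s4 = S - y\<close> and \<open>s2 + s3 = S - z\<close>. The remaining edge bounds
    confine \<open>y\<close> and \<open>z\<close> to a box. The loop bounds become bounds on
    \<open>y + z\<close> and \<open>y - z\<close>, because \<open>2 * s1 = y + z - A34\<close>,
    \<open>2 * s2 = 2 * A12 + A34 - y - z\<close>, \<open>2 * s3 = y - z + A34\<close> and
    \<open>2 * s4 = z - y + A34\<close>.\<close>
  define S where "S = A12 + A34"
  define ylo where "ylo = max A13 (S - r24)"
  define yhi where "yhi = min r13 (S - A24)"
  define zlo where "zlo = max A14 (S - r23)"
  define zhi where "zhi = min r14 (S - A23)"
  have box: "ylo \<le> yhi" "zlo \<le> zhi"
    using Ar big cap by (auto simp: ylo_def yhi_def zlo_def zhi_def S_def)
  \<comment> \<open>Each of the four loop bounds holds at the corner of the box most favourable to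
    it.\<close>
  have sum_hi: "A34 - c1 \<le> yhi + zhi"
    using Ar big cap tri(1-3) unfolding yhi_def zhi_def S_def min_def by (simp split: if_splits; linarith)
  have sum_lo: "ylo + zlo \<le> 2 * A12 + A34 + c2"
    using Ar big cap tri(4-6) unfolding ylo_def zlo_def S_def max_def by (simp split: if_splits; linarith)
  have diff_hi: "- A34 - c3 \<le> yhi - zlo"
    using Ar big cap tri(7-9) unfolding yhi_def zlo_def S_def min_def max_def by (simp split: if_splits; linarith)
  have diff_lo: "ylo - zhi \<le> A34 + c4"
    using Ar big cap tri(10-12) unfolding ylo_def zhi_def S_def min_def max_def by (simp split:
        if_splits; linarith)
  have ylb: "ylo \<ge> - c1" "ylo \<ge> - c3" "zlo \<ge> - c1" "zlo \<ge> - c4"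
    using Ac by (auto simp: ylo_def zlo_def)
  have yub: "yhi \<le> S + c2" "yhi \<le> S + c4" "zhi \<le> S + c2" "zhi \<le> S + c3"
    using Ac by (auto simp: yhi_def zhi_def)
  obtain y z where yz: "ylo \<le> y" "y \<le> yhi" "zlo \<le> z" "z \<le> zhi"
      "A34 - c1 \<le> y + z" "y + z \<le> 2 * A12 + A34 + c2" "- A34 - c3 \<le> y - z" "y - z \<le> A34 + c4"
  proof -
    \<comment> \<open>Start at the lower corner, which meets the upper bound on \<open>y + z\<close>
      by \<open>sum_lo\<close>. If one of the other three bounds fails there, move inside the box
      just far enough to make that bound tight; the remaining bounds survive by \<open>Ac\<close>,
      through \<open>ylb\<close> and \<open>yub\<close>.\<close>
    consider "ylo + zlo < A34 - c1" | "ylo - zlo < - A34 - c3" | "ylo - zlo > A34 + c4"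
      | "A34 - c1 \<le> ylo + zlo" "- A34 - c3 \<le> ylo - zlo" "ylo - zlo \<le> A34 + c4"
      by linarith
    then show ?thesis
    proof cases
      case 1
      then obtain y z where "ylo \<le> y" "y \<le> yhi" "zlo \<le> z" "z \<le> zhi" "y + z = A34 - c1"
        using interval_sum_attained[OF box, of "A34 - c1"] sum_hi by auto
      then show ?thesis using that[of y z] ylb Ac by linarith
    next
      case 2
      then have "ylo \<le> zlo - A34 - c3" "zlo - A34 - c3 \<le> yhi" using diff_hi by linarith+
      then show ?thesis using that[of "zlo - A34 - c3" zlo] box 2 ylb yub Ac sum_lo sum_hi unfolding S_def
        by linarith
    next
      case 3
      then have "zlo \<le> ylo - A34 - c4" "ylo - A34 - c4 \<le> zhi" using diff_lo by linarith+
      then show ?thesis using that[of ylo "ylo - A34 - c4"] box 3 ylb yub Ac unfolding S_def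
        by linarith
    next
      case 4
      then show ?thesis using that[of ylo zlo] box sum_lo by linarith
    qed
  qed
  have y: "A13 \<le> y" "S - r24 \<le> y" "y \<le> r13" "y \<le> S - A24"
    and z: "A14 \<le> z" "S - r23 \<le> z" "z \<le> r14" "z \<le> S - A23"
    using yz(1-4) by (auto simp: ylo_def yhi_def zlo_def zhi_def)
  show ?thesis
    apply (rule exI[of _ "(y + z - A34) / 2"])
    apply (rule exI[of _ "(2 * A12 + A34 - y - z) / 2"])
    apply (rule exI[of _ "(y - z + A34) / 2"])
    apply (rule exI[of _ "(z - y + A34) / 2"])
    using y z yz(5-8) Ar unfolding S_def by (auto simp: field_simps)
qed

text \<open>Relabelling the vertices 2, 3, 4 permutes the three perfect matchings, so the heaviest
  one can be moved to the edges 12 and 34: cases 2 and 3 exchange vertex 2 with vertex 3 and with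
  vertex 4.\<close>

lemma matching_potential:
  fixes A12 A13 A14 A23 A24 A34 r12 r13 r14 r23 r24 r34 c1 c2 c3 c4 :: real
  assumes Ar: "A12 \<le> r12" "A13 \<le> r13" "A14 \<le> r14" "A23 \<le> r23" "A24 \<le> r24" "A34 \<le> r34"
    and Ac: "A12 \<ge> - c1" "A12 \<ge> - c2" "A13 \<ge> - c1" "A13 \<ge> - c3" "A14 \<ge> - c1" "A14 \<ge> - c4"
      "A23 \<ge> - c2" "A23 \<ge> - c3" "A24 \<ge> - c2" "A24 \<ge> - c4" "A34 \<ge> - c3" "A34 \<ge> - c4"
    and cap: "A12 + A34 \<le> r13 + r24" "A12 + A34 \<le> r14 + r23" "A13 + A24 \<le> r12 + r34"
      "A13 + A24 \<le> r14 + r23" "A14 + A23 \<le> r12 + r34" "A14 + A23 \<le> r13 + r24"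
    and tri: "A23 \<le> A12 + A13 + c1" "A24 \<le> A12 + A14 + c1" "A34 \<le> A13 + A14 + c1"
      "A13 \<le> A12 + A23 + c2" "A14 \<le> A12 + A24 + c2" "A34 \<le> A23 + A24 + c2"
      "A12 \<le> A13 + A23 + c3" "A14 \<le> A13 + A34 + c3" "A24 \<le> A23 + A34 + c3"
      "A12 \<le> A14 + A24 + c4" "A13 \<le> A14 + A34 + c4" "A23 \<le> A24 + A34 + c4"
  shows "\<exists>s1 s2 s3 s4. A12 \<le> s1 + s2 \<and> s1 + s2 \<le> r12 \<and> A13 \<le> s1 + s3 \<and> s1 + s3 \<le> r13 \<and>
    A14 \<le> s1 + s4 \<and> s1 + s4 \<le> r14 \<and> A23 \<le> s2 + s3 \<and> s2 + s3 \<le> r23 \<and>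
    A24 \<le> s2 + s4 \<and> s2 + s4 \<le> r24 \<and> A34 \<le> s3 + s4 \<and> s3 + s4 \<le> r34 \<and>
    - c1 \<le> 2 * s1 \<and> - c2 \<le> 2 * s2 \<and> - c3 \<le> 2 * s3 \<and> - c4 \<le> 2 * s4"
proof -
  consider "A13 + A24 \<le> A12 + A34" "A14 + A23 \<le> A12 + A34"
    | "A12 + A34 \<le> A13 + A24" "A14 + A23 \<le> A13 + A24"
    | "A12 + A34 \<le> A14 + A23" "A13 + A24 \<le> A14 + A23"
    by linarith
  then show ?thesis
  proof cases
    case 1
    then show ?thesis by (intro tight_matching_potential assms) auto
  next
    case 2
    have "\<exists>s1 s3 s2 s4. A13 \<le> s1 + s3 \<and> s1 + s3 \<le> r13 \<and> A12 \<le> s1 + s2 \<and> s1 + s2 \<le> r12 \<and>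
      A14 \<le> s1 + s4 \<and> s1 + s4 \<le> r14 \<and> A23 \<le> s3 + s2 \<and> s3 + s2 \<le> r23 \<and>
      A34 \<le> s3 + s4 \<and> s3 + s4 \<le> r34 \<and> A24 \<le> s2 + s4 \<and> s2 + s4 \<le> r24 \<and>
      - c1 \<le> 2 * s1 \<and> - c3 \<le> 2 * s3 \<and> - c2 \<le> 2 * s2 \<and> - c4 \<le> 2 * s4"
      by (rule tight_matching_potential) (use assms 2 in \<open>simp_all only: add_ac\<close>)
    then show ?thesis
      by (elim exE, rename_tac s1 s3 s2 s4, rule_tac x = s1 in exI, rule_tac x = s2 in exI,
          rule_tac x = s3 in exI, rule_tac x = s4 in exI, simp only: add_ac)
  next
    case 3
    have "\<exists>s1 s4 s3 s2. A14 \<le> s1 + s4 \<and> s1 + s4 \<le> r14 \<and> A13 \<le> s1 + s3 \<and> s1 + s3 \<le> r13 \<and>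
      A12 \<le> s1 + s2 \<and> s1 + s2 \<le> r12 \<and> A34 \<le> s4 + s3 \<and> s4 + s3 \<le> r34 \<and>
      A24 \<le> s4 + s2 \<and> s4 + s2 \<le> r24 \<and> A23 \<le> s3 + s2 \<and> s3 + s2 \<le> r23 \<and>
      - c1 \<le> 2 * s1 \<and> - c4 \<le> 2 * s4 \<and> - c3 \<le> 2 * s3 \<and> - c2 \<le> 2 * s2"
      by (rule tight_matching_potential) (use assms 3 in \<open>simp_all only: add_ac\<close>)
    then show ?thesis
      by (elim exE, rename_tac s1 s4 s3 s2, rule_tac x = s1 in exI, rule_tac x = s2 in exI,
          rule_tac x = s3 in exI, rule_tac x = s4 in exI, simp only: add_ac)
  qed
qed

section \<open>Solving for the coefficients of the auxiliary variables\<close>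

text \<open>
  For the multilinear polynomial \<open>- f\<close>, \<open>rij\<close> stands for the coefficient of the product of
  the two variables other than \<open>xi, xj\<close>, \<open>ci\<close> for the coefficient of the product of the
  three variables other than \<open>xi\<close>, and \<open>d\<close> for the coefficient of \<open>x1 x2 x3 x4\<close>. The last
  six inequalities are the ones that go beyond nonnegative second differences.
\<close>

definition difference_bounds where
  "difference_bounds r12 r13 r14 r23 r24 r34 c1 c2 c3 c4 (d::real) \<longleftrightarrow>
    r12 \<ge> 0 \<and> r13 \<ge> 0 \<and> r14 \<ge> 0 \<and> r23 \<ge> 0 \<and> r24 \<ge> 0 \<and> r34 \<ge> 0 \<and>
    r12 + c1 \<ge> 0 \<and> r12 + c2 \<ge> 0 \<and> r12 + c1 + c2 + d \<ge> 0 \<and>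
    r13 + c1 \<ge> 0 \<and> r13 + c3 \<ge> 0 \<and> r13 + c1 + c3 + d \<ge> 0 \<and>
    r14 + c1 \<ge> 0 \<and> r14 + c4 \<ge> 0 \<and> r14 + c1 + c4 + d \<ge> 0 \<and>
    r23 + c2 \<ge> 0 \<and> r23 + c3 \<ge> 0 \<and> r23 + c2 + c3 + d \<ge> 0 \<and>
    r24 + c2 \<ge> 0 \<and> r24 + c4 \<ge> 0 \<and> r24 + c2 + c4 + d \<ge> 0 \<and>
    r34 + c3 \<ge> 0 \<and> r34 + c4 \<ge> 0 \<and> r34 + c3 + c4 + d \<ge> 0 \<and>
    r12 + r34 + c1 + c2 \<ge> 0 \<and> r12 + r34 + c3 + c4 \<ge> 0 \<and>
    r13 + r24 + c1 + c3 \<ge> 0 \<and> r13 + r24 + c2 + c4 \<ge> 0 \<and>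
    r14 + r23 + c1 + c4 \<ge> 0 \<and> r14 + r23 + c2 + c3 \<ge> 0"

text \<open>
  The negated objective with auxiliary variables \<open>z1, z2\<close> will be a quadratic polynomial
  in \<open>x\<close> plus \<open>z1 * (\<Sum>i. (S - si - h) * xi - (S - 2 * h))\<close>, with \<open>S = s1 + s2 + s3 + s4\<close>,
  plus \<open>z2 * (\<Sum>i. (E - ei) * xi - (3 * E - e1 - e2 - e3 - e4) - E) + E * z1 * z2\<close>. The
  factor of \<open>z1\<close> equals \<open>sk + sl\<close> at the point with support \<open>{1,2,3,4} - {k,l}\<close>. When
  \<open>z1 = 1\<close>, the factor of \<open>z2\<close> is \<open>ei\<close> at the point of weight 3 with \<open>xi = 0\<close>, and \<open>E\<close> at
  the point of weight 4. The maximum of the terms with \<open>z1, z2\<close> at the point with support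
  \<open>{i,j}\<close> is \<open>mij\<close>.
\<close>

definition threshold_system where
  "threshold_system r12 r13 r14 r23 r24 (r34::real) s1 s2 s3 s4 h
      m12 m13 m14 m23 m24 m34 e1 e2 e3 e4 E \<longleftrightarrow>
    m34 \<le> r12 \<and> m24 \<le> r13 \<and> m23 \<le> r14 \<and> m14 \<le> r23 \<and> m13 \<le> r24 \<and> m12 \<le> r34 \<and>
    h \<le> s1 \<and> h \<le> s2 \<and> h \<le> s3 \<and> h \<le> s4 \<and>
    h \<le> s2 + s3 + s4 \<and> h \<le> s1 + s3 + s4 \<and> h \<le> s1 + s2 + s4 \<and> h \<le> s1 + s2 + s3 \<and>
    h \<le> s1 + s1 + s2 + s3 + s4 \<and> h \<le> s2 + s1 + s2 + s3 + s4 \<and>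
    h \<le> s3 + s1 + s2 + s3 + s4 \<and> h \<le> s4 + s1 + s2 + s3 + s4 \<and>
    0 \<le> e1 \<and> 0 \<le> e2 \<and> 0 \<le> e3 \<and> 0 \<le> e4 \<and> e1 \<le> E \<and> e2 \<le> E \<and> e3 \<le> E \<and> e4 \<le> E \<and>
    e1 + e2 - E \<le> m34 - (s1 + s2) \<and> e1 + e3 - E \<le> m24 - (s1 + s3) \<and>
    e1 + e4 - E \<le> m23 - (s1 + s4) \<and> e2 + e3 - E \<le> m14 - (s2 + s3) \<and>
    e2 + e4 - E \<le> m13 - (s2 + s4) \<and> e3 + e4 - E \<le> m12 - (s3 + s4) \<and>
    e2 + e3 + e4 \<le> 2 * E \<and> e1 + e3 + e4 \<le> 2 * E \<and> e1 + e2 + e4 \<le> 2 * E \<and> e1 + e2 + e3 \<le> 2 * E"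

definition opposite_positive_parts where
  "opposite_positive_parts s1 s2 s3 (s4::real) m12 m13 m14 m23 m24 m34 \<longleftrightarrow>
    m12 = max 0 (s3 + s4) \<and> m13 = max 0 (s2 + s4) \<and> m14 = max 0 (s2 + s3) \<and>
    m23 = max 0 (s1 + s4) \<and> m24 = max 0 (s1 + s3) \<and> m34 = max 0 (s1 + s2)"

text \<open>These values come from equating the polynomial with both auxiliary variables on to
  \<open>- f\<close>: at the point of weight 3 with \<open>xi = 0\<close> for \<open>ei\<close>, at
  the point of weight 4 for \<open>E\<close>.\<close>

definition threshold_values where
  "threshold_values c1 c2 c3 c4 (d::real) s1 s2 s3 s4 h m12 m13 m14 m23 m24 m34 e1 e2 e3 e4 E \<longleftrightarrow>
    e1 = c1 + m23 + m24 + m34 + h - (s1 + s1 + s2 + s3 + s4) \<and>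
    e2 = c2 + m13 + m14 + m34 + h - (s2 + s1 + s2 + s3 + s4) \<and>
    e3 = c3 + m12 + m14 + m24 + h - (s3 + s1 + s2 + s3 + s4) \<and>
    e4 = c4 + m12 + m13 + m23 + h - (s4 + s1 + s2 + s3 + s4) \<and>
    E = c1 + c2 + c3 + c4 + d + m12 + m13 + m14 + m23 + m24 + m34 + 2 * h
      - 2 * (s1 + s2 + s3 + s4)"

definition threshold_solvable where
  "threshold_solvable r12 r13 r14 r23 r24 r34 c1 c2 c3 c4 (d::real) \<longleftrightarrow>
    (\<exists>s1 s2 s3 s4 h m12 m13 m14 m23 m24 m34 e1 e2 e3 e4 E.
      opposite_positive_parts s1 s2 s3 s4 m12 m13 m14 m23 m24 m34 \<and>
      threshold_values c1 c2 c3 c4 d s1 s2 s3 s4 h m12 m13 m14 m23 m24 m34 e1 e2 e3 e4 E \<and>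
      threshold_system r12 r13 r14 r23 r24 r34 s1 s2 s3 s4 h m12 m13 m14 m23 m24 m34 e1 e2 e3 e4 E)"

section \<open>Symmetry under permutations of the four variables\<close>

lemma threshold_solvable_swap12:
  assumes "threshold_solvable r12 r23 r24 r13 r14 r34 c2 c1 c3 c4 d"
  shows "threshold_solvable r12 r13 r14 r23 r24 r34 c1 c2 c3 c4 d"
proof -
  obtain s1 s2 s3 s4 h m12 m13 m14 m23 m24 m34 e1 e2 e3 e4 E where
    m: "opposite_positive_parts s1 s2 s3 s4 m12 m13 m14 m23 m24 m34"
    and v: "threshold_values c2 c1 c3 c4 d s1 s2 s3 s4 h m12 m13 m14 m23 m24 m34 e1 e2 e3 e4 E"
    and *: "threshold_system r12 r23 r24 r13 r14 r34 s1 s2 s3 s4 h m12 m13 m14 m23 m24 m34 e1 e2 e3 e4 E"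
    using assms by (auto simp: threshold_solvable_def)
  have "threshold_system r12 r13 r14 r23 r24 r34 s2 s1 s3 s4 h m12 m23 m24 m13 m14 m34 e2 e1 e3 e4 E"
    using * by (simp only: threshold_system_def add_ac conj_ac)
  moreover have "threshold_values c1 c2 c3 c4 d s2 s1 s3 s4 h m12 m23 m24 m13 m14 m34 e2 e1 e3 e4 E"
    using v by (auto simp: threshold_values_def)
  moreover have "opposite_positive_parts s2 s1 s3 s4 m12 m23 m24 m13 m14 m34"
    using m by (simp add: opposite_positive_parts_def add.commute)
  ultimately show ?thesis unfolding threshold_solvable_def by blast
qed

lemma threshold_solvable_swap23:
  assumes "threshold_solvable r13 r12 r14 r23 r34 r24 c1 c3 c2 c4 d"
  shows "threshold_solvable r12 r13 r14 r23 r24 r34 c1 c2 c3 c4 d"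
proof -
  obtain s1 s2 s3 s4 h m12 m13 m14 m23 m24 m34 e1 e2 e3 e4 E where
    m: "opposite_positive_parts s1 s2 s3 s4 m12 m13 m14 m23 m24 m34"
    and v: "threshold_values c1 c3 c2 c4 d s1 s2 s3 s4 h m12 m13 m14 m23 m24 m34 e1 e2 e3 e4 E"
    and *: "threshold_system r13 r12 r14 r23 r34 r24 s1 s2 s3 s4 h m12 m13 m14 m23 m24 m34 e1 e2 e3 e4 E"
    using assms by (auto simp: threshold_solvable_def)
  have "threshold_system r12 r13 r14 r23 r24 r34 s1 s3 s2 s4 h m13 m12 m14 m23 m34 m24 e1 e3 e2 e4 E"
    using * by (simp only: threshold_system_def add_ac conj_ac)
  moreover have "threshold_values c1 c2 c3 c4 d s1 s3 s2 s4 h m13 m12 m14 m23 m34 m24 e1 e3 e2 e4 E"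
    using v by (auto simp: threshold_values_def)
  moreover have "opposite_positive_parts s1 s3 s2 s4 m13 m12 m14 m23 m34 m24"
    using m by (simp add: opposite_positive_parts_def add.commute)
  ultimately show ?thesis unfolding threshold_solvable_def by blast
qed

lemma threshold_solvable_swap34:
  assumes "threshold_solvable r12 r14 r13 r24 r23 r34 c1 c2 c4 c3 d"
  shows "threshold_solvable r12 r13 r14 r23 r24 r34 c1 c2 c3 c4 d"
proof -
  obtain s1 s2 s3 s4 h m12 m13 m14 m23 m24 m34 e1 e2 e3 e4 E where
    m: "opposite_positive_parts s1 s2 s3 s4 m12 m13 m14 m23 m24 m34"
    and v: "threshold_values c1 c2 c4 c3 d s1 s2 s3 s4 h m12 m13 m14 m23 m24 m34 e1 e2 e3 e4 E"
    and *: "threshold_system r12 r14 r13 r24 r23 r34 s1 s2 s3 s4 h m12 m13 m14 m23 m24 m34 e1 e2 e3 e4 E"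
    using assms by (auto simp: threshold_solvable_def)
  have "threshold_system r12 r13 r14 r23 r24 r34 s1 s2 s4 s3 h m12 m14 m13 m24 m23 m34 e1 e2 e4 e3 E"
    using * by (simp only: threshold_system_def add_ac conj_ac)
  moreover have "threshold_values c1 c2 c3 c4 d s1 s2 s4 s3 h m12 m14 m13 m24 m23 m34 e1 e2 e4 e3 E"
    using v by (auto simp: threshold_values_def)
  moreover have "opposite_positive_parts s1 s2 s4 s3 m12 m14 m13 m24 m23 m34"
    using m by (simp add: opposite_positive_parts_def add.commute)
  ultimately show ?thesis unfolding threshold_solvable_def by blast
qed

section \<open>Solutions with no gap, one gap and two gaps\<close>

text \<open>A solution is sought with every \<open>si + sj\<close> nonnegative, so that the positive
  parts disappear. What is left asks for interval bounds on the edge sums and loop bounds, which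
  \<open>matching_potential\<close> can meet.\<close>

lemma threshold_solvable_if_no_gap:
  assumes D: "difference_bounds r12 r13 r14 r23 r24 r34 c1 c2 c3 c4 d"
    and gap: "0 \<le> r13 + r24 + c1 + c2 + d" "0 \<le> r14 + r23 + c1 + c2 + d"
      "0 \<le> r13 + r24 + c3 + c4 + d" "0 \<le> r14 + r23 + c3 + c4 + d"
      "0 \<le> r12 + r34 + c1 + c3 + d" "0 \<le> r14 + r23 + c1 + c3 + d"
      "0 \<le> r12 + r34 + c2 + c4 + d" "0 \<le> r14 + r23 + c2 + c4 + d"
      "0 \<le> r12 + r34 + c1 + c4 + d" "0 \<le> r13 + r24 + c1 + c4 + d"
      "0 \<le> r12 + r34 + c2 + c3 + d" "0 \<le> r13 + r24 + c2 + c3 + d"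
  shows "threshold_solvable r12 r13 r14 r23 r24 r34 c1 c2 c3 c4 d"
proof -
  \<comment> \<open>\<open>A ci cj\<close> is the lower bound needed for \<open>si + sj\<close>: 0
    makes the sum its own positive part, \<open>- ci\<close> and \<open>- cj\<close> serve
    \<open>ei >= 0\<close> and \<open>ej >= 0\<close> when \<open>h\<close> is \<open>sj\<close> or
    \<open>si\<close>, and \<open>- ci - cj - d\<close> keeps the sum of the other two
    \<open>e\<close> at most \<open>E\<close>.\<close>
  define A where "A = (\<lambda>a b. max (max 0 (- a)) (max (- b) (- a - b - d)))"
  note D' = D[unfolded difference_bounds_def]
  have cases: "A a b = 0 \<or> A a b = - a \<or> A a b = - b \<or> A a b = - a - b - d" for a b
    by (auto simp: A_def max_def)
  have lower: "A a b \<ge> 0" "A a b \<ge> - a" "A a b \<ge> - b" "A a b \<ge> - a - b - d" for a b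
    by (auto simp: A_def)
  have tri: "A b c \<le> A a b + A a c + a" "A b c \<le> A b a + A a c + a" "A b c \<le> A b a + A c a + a" for a
      b c
    using cases[of b c] lower[of a b] lower[of a c] lower[of b a] lower[of c a] by linarith+
  have match: "A a b + A p q \<le> U"
    if "0 \<le> U" "- a \<le> U" "- b \<le> U" "- p \<le> U" "- q \<le> U" "- a - p \<le> U" "- a - q \<le> U"
      "- b - p \<le> U" "- b - q \<le> U" "- a - b - d \<le> U" "- p - q - d \<le> U"
      "- a - b - d - p \<le> U" "- a - b - d - q \<le> U" "- a - p - q - d \<le> U" "- b - p - q - d \<le> U"
      "- a - b - d - p - q - d \<le> U" for a b p q U
    using cases[of a b] cases[of p q] that by linarith
  have "\<exists>s1 s2 s3 s4. A c1 c2 \<le> s1 + s2 \<and> s1 + s2 \<le> r12 \<and> A c1 c3 \<le> s1 + s3 \<and> s1 + s3 \<le> r13 \<and>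
    A c1 c4 \<le> s1 + s4 \<and> s1 + s4 \<le> r14 \<and> A c2 c3 \<le> s2 + s3 \<and> s2 + s3 \<le> r23 \<and>
    A c2 c4 \<le> s2 + s4 \<and> s2 + s4 \<le> r24 \<and> A c3 c4 \<le> s3 + s4 \<and> s3 + s4 \<le> r34 \<and>
    - c1 \<le> 2 * s1 \<and> - c2 \<le> 2 * s2 \<and> - c3 \<le> 2 * s3 \<and> - c4 \<le> 2 * s4"
  proof (rule matching_potential)
    show "A c1 c2 \<le> r12" "A c1 c3 \<le> r13" "A c1 c4 \<le> r14" "A c2 c3 \<le> r23" "A c2 c4 \<le> r24"
        "A c3 c4 \<le> r34"
      using D' by (auto simp: A_def)
    \<comment> \<open>Expanding both maxima leaves sixteen comparisons. The candidate
      \<open>- ci - cj - d\<close> taken with 0 needs \<open>gap\<close>; \<open>- ci - ck\<close>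
      with the edge ik in the matching on the right needs the six inequalities beyond second
      differences.\<close>
    show "A c1 c2 + A c3 c4 \<le> r13 + r24" "A c1 c2 + A c3 c4 \<le> r14 + r23"
        "A c1 c3 + A c2 c4 \<le> r12 + r34"
      "A c1 c3 + A c2 c4 \<le> r14 + r23" "A c1 c4 + A c2 c3 \<le> r12 + r34" "A c1 c4 + A c2 c3 \<le> r13 + r24"
      by (rule match; use D' gap in linarith)+
  qed (rule lower tri)+
  then obtain s1 s2 s3 s4 where
      up: "s1 + s2 \<le> r12" "s1 + s3 \<le> r13" "s1 + s4 \<le> r14" "s2 + s3 \<le> r23" "s2 + s4 \<le> r24"
          "s3 + s4 \<le> r34"
    and low: "A c1 c2 \<le> s1 + s2" "A c1 c3 \<le> s1 + s3" "A c1 c4 \<le> s1 + s4"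
      "A c2 c3 \<le> s2 + s3" "A c2 c4 \<le> s2 + s4" "A c3 c4 \<le> s3 + s4"
    and loop: "- c1 \<le> 2 * s1" "- c2 \<le> 2 * s2" "- c3 \<le> 2 * s3" "- c4 \<le> 2 * s4"
    by auto
  have pos: "0 \<le> s1 + s2" "0 \<le> s1 + s3" "0 \<le> s1 + s4" "0 \<le> s2 + s3" "0 \<le> s2 + s4" "0 \<le> s3 + s4"
    and g: "0 \<le> c1 + c2 + d + s1 + s2" "0 \<le> c1 + c3 + d + s1 + s3" "0 \<le> c1 + c4 + d + s1 + s4"
      "0 \<le> c2 + c3 + d + s2 + s3" "0 \<le> c2 + c4 + d + s2 + s4" "0 \<le> c3 + c4 + d + s3 + s4"
    and l: "- c1 \<le> s1 + s2" "- c2 \<le> s1 + s2" "- c1 \<le> s1 + s3" "- c3 \<le> s1 + s3" "- c1 \<le> s1 + s4"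
        "- c4 \<le> s1 + s4"
      "- c2 \<le> s2 + s3" "- c3 \<le> s2 + s3" "- c2 \<le> s2 + s4" "- c4 \<le> s2 + s4" "- c3 \<le> s3 + s4"
          "- c4 \<le> s3 + s4"
    using low by (auto simp: A_def)
  \<comment> \<open>This is the largest \<open>h\<close> that keeps the first auxiliary variable off
    at weight 1. In \<open>ei >= 0\<close>, the case \<open>h = si\<close> is the loop bound and
    \<open>h = sj\<close> is the edge bound \<open>- ci <= si + sj\<close>.\<close>
  define h where "h = min (min s1 s2) (min s3 s4)"
  have h: "h \<le> s1" "h \<le> s2" "h \<le> s3" "h \<le> s4" and h_cases: "h = s1 \<or> h = s2 \<or> h = s3 \<or> h = s4"
    by (auto simp: h_def min_def)
  define e1 where "e1 = c1 + s1 + h"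
  define e2 where "e2 = c2 + s2 + h"
  define e3 where "e3 = c3 + s3 + h"
  define e4 where "e4 = c4 + s4 + h"
  define E where "E = c1 + c2 + c3 + c4 + d + s1 + s2 + s3 + s4 + 2 * h"
  have e: "0 \<le> e1" "0 \<le> e2" "0 \<le> e3" "0 \<le> e4"
    unfolding e1_def e2_def e3_def e4_def using h_cases loop l by auto
  have EE: "e1 + e2 \<le> E" "e1 + e3 \<le> E" "e1 + e4 \<le> E" "e2 + e3 \<le> E" "e2 + e4 \<le> E" "e3 + e4 \<le> E"
    unfolding e1_def e2_def e3_def e4_def E_def using g by linarith+
  have "opposite_positive_parts s1 s2 s3 s4 (s3 + s4) (s2 + s4) (s2 + s3) (s1 + s4) (s1 + s3) (s1 + s2)"
    using pos by (simp add: opposite_positive_parts_def)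
  moreover have "threshold_values c1 c2 c3 c4 d s1 s2 s3 s4 h
      (s3 + s4) (s2 + s4) (s2 + s3) (s1 + s4) (s1 + s3) (s1 + s2) e1 e2 e3 e4 E"
    by (simp add: threshold_values_def e1_def e2_def e3_def e4_def E_def)
  moreover have "threshold_system r12 r13 r14 r23 r24 r34 s1 s2 s3 s4 h
      (s3 + s4) (s2 + s4) (s2 + s3) (s1 + s4) (s1 + s3) (s1 + s2) e1 e2 e3 e4 E"
    unfolding threshold_system_def
    apply (intro conjI)
    subgoal using up by simp subgoal using up by simp subgoal using up by simp
    subgoal using up by simp subgoal using up by simp subgoal using up by simp
    apply (fact h)+
    using e EE h pos by linarith+
  ultimately show ?thesis unfolding threshold_solvable_def by blast
qed

text \<open>
  In the next two lemmas the gap forces \<open>s3 + s4 < 0\<close>, and one can take \<open>s1 + s3 = r13\<close>,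
  \<open>s2 + s4 = r24\<close> and \<open>s1 + s2 = - c1 - c2 - d\<close>; the only freedom left is \<open>z = s1 + s4\<close>.
\<close>

lemma threshold_solvable_if_one_gap:
  assumes D: "difference_bounds r12 r13 r14 r23 r24 r34 c1 c2 c3 c4 d"
    and gap: "r13 + r24 + c1 + c2 + d < 0" and le: "r13 + r24 \<le> r14 + r23"
    and nogap: "0 \<le> r13 + r24 + c1 + c4 + d" "0 \<le> r13 + r24 + c2 + c3 + d"
  shows "threshold_solvable r12 r13 r14 r23 r24 r34 c1 c2 c3 c4 d"
proof -
  note D' = D[unfolded difference_bounds_def]
  define R where "R = r13 + r24"
  define g where "g = - c1 - c2 - d"
  \<comment> \<open>Every lower bound for \<open>z\<close> is compared with every upper one. They
    stem from \<open>0 <= s1 + s4 <= r14\<close>, from \<open>0 <= s2 + s3 <= r23\<close> with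
    \<open>s2 + s3 = R - z\<close>, from \<open>ei >= 0\<close>, and from
    \<open>e2 + e3 <= E\<close> and \<open>e1 + e4 <= E\<close>. Both \<open>le\<close> and
    \<open>nogap\<close> enter here.\<close>
  have between:
    "0 \<le> r14" "0 \<le> R" "0 \<le> R + c2 + c3 + d" "0 \<le> R + c2" "0 \<le> c3 + r13"
    "- c1 - c4 - d \<le> r14" "- c1 - c4 - d \<le> R" "- c1 - c4 - d \<le> R + c2 + c3 + d"
        "- c1 - c4 - d \<le> R + c2" "- c1 - c4 - d \<le> c3 + r13"
    "- c1 \<le> r14" "- c1 \<le> R" "- c1 \<le> R + c2 + c3 + d" "- c1 \<le> R + c2" "- c1 \<le> c3 + r13"
    "R - r23 \<le> r14" "R - r23 \<le> R" "R - r23 \<le> R + c2 + c3 + d" "R - r23 \<le> R + c2" "R - r23 \<le> c3 + r13"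
    "r13 - c4 \<le> r14" "r13 - c4 \<le> R" "r13 - c4 \<le> R + c2 + c3 + d" "r13 - c4 \<le> R + c2"
        "r13 - c4 \<le> c3 + r13"
    unfolding R_def using D' gap le nogap by linarith+
  obtain z where z_low: "0 \<le> z" "- c1 - c4 - d \<le> z" "- c1 \<le> z" "R - r23 \<le> z" "r13 - c4 \<le> z"
    and z_up: "z \<le> r14" "z \<le> R" "z \<le> R + c2 + c3 + d" "z \<le> R + c2" "z \<le> c3 + r13"
    by (rule that[of "max (max 0 (- c1 - c4 - d)) (max (max (- c1) (R - r23)) (r13 - c4))"])
      (use between in \<open>simp_all only: le_max_iff_disj max.bounded_iff order_refl simp_thms\<close>)
  have g: "R < g" "g \<le> r12" "r13 \<le> g" "r24 \<le> g" "0 \<le> r13" "0 \<le> r24" "0 \<le> r34"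
    using D' gap by (auto simp: g_def R_def)
  have c: "0 \<le> c1 + r13" "0 \<le> c2 + r24" "0 \<le> c3" "0 \<le> c4" "0 \<le> r13 + c1 + c3 + d"
      "0 \<le> r24 + c2 + c4 + d"
    "c3 + c4 + d \<ge> 0"
    using D' gap by linarith+
  define s1 where "s1 = (g + z - r24) / 2"
  define s2 where "s2 = (g + r24 - z) / 2"
  define s3 where "s3 = (R + r13 - g - z) / 2"
  define s4 where "s4 = (z + r24 - g) / 2"
  have t: "s1 + s2 = g" "s1 + s3 = r13" "s1 + s4 = z" "s2 + s3 = R - z" "s2 + s4 = r24" "s3 + s4 = R - g"
    by (auto simp: s1_def s2_def s3_def s4_def R_def field_simps)
  \<comment> \<open>This is again the minimum of all four: \<open>s1 - s4 = g - r24\<close> and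
    \<open>s2 - s3 = g - r13\<close> are nonnegative.\<close>
  define h where "h = min s3 s4"
  have h: "h \<le> s1" "h \<le> s2" "h \<le> s3" "h \<le> s4" and h_cases: "h = s3 \<or> h = s4"
    using t g z_low by (auto simp: h_def min_def)
  define e1 where "e1 = c1 + s1 + h"
  define e2 where "e2 = c2 + s2 + h"
  define e3 where "e3 = c3 - s4 + h"
  define e4 where "e4 = c4 - s3 + h"
  define E where "E = c1 + c2 + c3 + c4 + d + s1 + s2 + 2 * h"
  have dif: "s3 - s4 = r13 - z"
    using t by linarith
  have e: "0 \<le> e1" "0 \<le> e2" "0 \<le> e3" "0 \<le> e4"
    unfolding e1_def e2_def e3_def e4_def using h_cases t c z_low z_up dif by linarith+
  have EE: "e1 + e2 \<le> E" "e1 + e3 \<le> E" "e1 + e4 \<le> E" "e2 + e3 \<le> E" "e2 + e4 \<le> E"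
    "e3 + e4 - E \<le> 0 - (s3 + s4)"
    unfolding e1_def e2_def e3_def e4_def E_def using t c z_low z_up g_def R_def by linarith+
  have "opposite_positive_parts s1 s2 s3 s4 0 (s2 + s4) (s2 + s3) (s1 + s4) (s1 + s3) (s1 + s2)"
    unfolding opposite_positive_parts_def t using g z_low z_up by simp
  moreover have "threshold_values c1 c2 c3 c4 d s1 s2 s3 s4 h
      0 (s2 + s4) (s2 + s3) (s1 + s4) (s1 + s3) (s1 + s2) e1 e2 e3 e4 E"
    by (simp add: threshold_values_def e1_def e2_def e3_def e4_def E_def)
  moreover have "threshold_system r12 r13 r14 r23 r24 r34 s1 s2 s3 s4 h
      0 (s2 + s4) (s2 + s3) (s1 + s4) (s1 + s3) (s1 + s2) e1 e2 e3 e4 E"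
    unfolding threshold_system_def
    apply (intro conjI)
    subgoal using t g by simp subgoal using t g by simp subgoal using t z_up by simp
    subgoal using t z_low by simp subgoal using t g by simp subgoal using g by simp
    apply (fact h)+
    using e EE h t g z_low z_up by linarith+
  ultimately show ?thesis unfolding threshold_solvable_def by blast
qed

lemma threshold_solvable_if_two_gaps:
  assumes D: "difference_bounds r12 r13 r14 r23 r24 r34 c1 c2 c3 c4 d"
    and gap: "r13 + r24 + c1 + c2 + d < 0" "r13 + r24 + c1 + c4 + d < 0"
  shows "threshold_solvable r12 r13 r14 r23 r24 r34 c1 c2 c3 c4 d"
proof -
  note D' = D[unfolded difference_bounds_def]
  define R where "R = r13 + r24"
  define g where "g = - c1 - c2 - d"
  \<comment> \<open>The second gap, at the point with support \<open>{1,4}\<close>, fixes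
    \<open>z\<close> in the way the first one fixes \<open>g\<close>, and makes
    \<open>s2 + s3 = R - z\<close> negative. The smallest potential is then \<open>s3\<close>, which
    takes the role of \<open>h\<close>.\<close>
  define z where "z = - c1 - c4 - d"
  have g: "R < g" "g \<le> r12" "R < z" "z \<le> r14" "R = r13 + r24"
      "0 \<le> r13" "0 \<le> r24" "0 \<le> r34" "0 \<le> r23"
    using D' gap by (auto simp: g_def z_def R_def)
  have c: "0 \<le> c1 + r13" "0 \<le> c2" "r24 \<le> c3" "0 \<le> c4" "0 \<le> r13 + c1 + c3 + d" "0 \<le> r24 + c2 + c4 + d"
    "c2 + c3 + d \<ge> 0" "c3 + c4 + d \<ge> 0"
    using D' gap by linarith+
  define s1 where "s1 = (g + z - r24) / 2"
  define s2 where "s2 = (g + r24 - z) / 2"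
  define s3 where "s3 = (R + r13 - g - z) / 2"
  define s4 where "s4 = (z + r24 - g) / 2"
  have t: "s1 + s2 = g" "s1 + s3 = r13" "s1 + s4 = z" "s2 + s3 = R - z" "s2 + s4 = r24" "s3 + s4 = R - g"
    by (auto simp: s1_def s2_def s3_def s4_def R_def field_simps)
  have h: "s3 \<le> s1" "s3 \<le> s2" "s3 \<le> s3" "s3 \<le> s4"
    using t g by linarith+
  define e1 where "e1 = c1 + s1 + s3"
  define e4 where "e4 = c4"
  define e3 where "e3 = c3 - s2 - s4"
  define e2 where "e2 = c2"
  define E where "E = c1 + c2 + c3 + c4 + d + s1 + s3"
  have e: "0 \<le> e1" "0 \<le> e2" "0 \<le> e3" "0 \<le> e4"
    unfolding e1_def e2_def e3_def e4_def using t c by linarith+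
  have EE: "e1 + e2 \<le> E" "e1 + e3 \<le> E" "e1 + e4 \<le> E" "e2 + e3 - E \<le> 0 - (s2 + s3)" "e2 + e4 \<le> E"
    "e3 + e4 - E \<le> 0 - (s3 + s4)"
    unfolding e1_def e2_def e3_def e4_def E_def using t c g_def z_def R_def by linarith+
  have "opposite_positive_parts s1 s2 s3 s4 0 (s2 + s4) 0 (s1 + s4) (s1 + s3) (s1 + s2)"
    unfolding opposite_positive_parts_def t using g by simp
  moreover have "threshold_values c1 c2 c3 c4 d s1 s2 s3 s4 s3
      0 (s2 + s4) 0 (s1 + s4) (s1 + s3) (s1 + s2) e1 e2 e3 e4 E"
    by (simp add: threshold_values_def e1_def e2_def e3_def e4_def E_def)
  moreover have "threshold_system r12 r13 r14 r23 r24 r34 s1 s2 s3 s4 s3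
      0 (s2 + s4) 0 (s1 + s4) (s1 + s3) (s1 + s2) e1 e2 e3 e4 E"
    unfolding threshold_system_def
    apply (intro conjI)
    subgoal using t g by simp subgoal using t g by simp subgoal using t g by simp
    subgoal using g by simp subgoal using t g by simp subgoal using g by simp
    apply (fact h)+
    using e EE h t g by linarith+
  ultimately show ?thesis unfolding threshold_solvable_def by blast
qed

section \<open>Reduction of all cases by symmetry\<close>

lemma difference_bounds_swaps:
  assumes "difference_bounds r12 r13 r14 r23 r24 r34 c1 c2 c3 c4 d"
  shows "difference_bounds r12 r23 r24 r13 r14 r34 c2 c1 c3 c4 d"
    "difference_bounds r13 r12 r14 r23 r34 r24 c1 c3 c2 c4 d"
    "difference_bounds r12 r14 r13 r24 r23 r34 c1 c2 c4 c3 d"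
  using assms by (simp_all only: difference_bounds_def add_ac conj_ac)

text \<open>Exchanging 3 and 4 swaps the matchings 13, 24 and 14, 23 and fixes
  \<open>c1 + c2\<close>, so the lighter of the two may be assumed to cause the gap. A second gap
  from this matching involves 1, 4 or 2, 3; exchanging 1 with 2 and 3 with 4 carries the latter to
  the former.\<close>

lemma threshold_solvable_if_gap:
  assumes D: "difference_bounds r12 r13 r14 r23 r24 r34 c1 c2 c3 c4 d"
    and gap: "r13 + r24 + c1 + c2 + d < 0"
  shows "threshold_solvable r12 r13 r14 r23 r24 r34 c1 c2 c3 c4 d"
proof -
  have minimal: "threshold_solvable r12 r13 r14 r23 r24 r34 c1 c2 c3 c4 d"
    if D: "difference_bounds r12 r13 r14 r23 r24 r34 c1 c2 c3 c4 d"
      and gap: "r13 + r24 + c1 + c2 + d < 0" and le: "r13 + r24 \<le> r14 + r23"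
    for r12 r13 r14 r23 r24 r34 c1 c2 c3 c4
  proof -
    consider "r13 + r24 + c1 + c4 + d < 0" | "r24 + r13 + c2 + c3 + d < 0"
      | "0 \<le> r13 + r24 + c1 + c4 + d" "0 \<le> r13 + r24 + c2 + c3 + d"
      by linarith
    then show ?thesis
    proof cases
      case 1
      then show ?thesis by (intro threshold_solvable_if_two_gaps D gap)
    next
      case 2
      have "r24 + r13 + c2 + c1 + d < 0" using gap by simp
      with 2 show ?thesis
        by - (rule threshold_solvable_swap12, rule threshold_solvable_swap34, 
            rule threshold_solvable_if_two_gaps[OF difference_bounds_swaps(3)[OF
                difference_bounds_swaps(1)[OF D]]])
    next
      case 3
      then show ?thesis by (intro threshold_solvable_if_one_gap D gap le)
    qed
  qed
  show ?thesis
  proof (cases "r13 + r24 \<le> r14 + r23")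
    case True
    then show ?thesis by (intro minimal D gap)
  next
    case False
    then show ?thesis using gap
      by - (rule threshold_solvable_swap34, rule minimal[OF difference_bounds_swaps(3)[OF D]], linarith+)
  qed
qed

text \<open>Bundling the bounds with unsolvability gives rules with a single premise, so that a
  permutation can be applied as a chain of transpositions.\<close>

lemma unsolvable_swaps:
  assumes "difference_bounds r12 r13 r14 r23 r24 r34 c1 c2 c3 c4 d \<and>
    \<not> threshold_solvable r12 r13 r14 r23 r24 r34 c1 c2 c3 c4 d"
  shows "difference_bounds r12 r23 r24 r13 r14 r34 c2 c1 c3 c4 d \<and>
      \<not> threshold_solvable r12 r23 r24 r13 r14 r34 c2 c1 c3 c4 d"
    "difference_bounds r13 r12 r14 r23 r34 r24 c1 c3 c2 c4 d \<and>
      \<not> threshold_solvable r13 r12 r14 r23 r34 r24 c1 c3 c2 c4 d"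
    "difference_bounds r12 r14 r13 r24 r23 r34 c1 c2 c4 c3 d \<and>
      \<not> threshold_solvable r12 r14 r13 r24 r23 r34 c1 c2 c4 c3 d"
proof -
  note D = conjunct1[OF assms] and U = conjunct2[OF assms]
  show "difference_bounds r12 r23 r24 r13 r14 r34 c2 c1 c3 c4 d \<and>
      \<not> threshold_solvable r12 r23 r24 r13 r14 r34 c2 c1 c3 c4 d"
    by (rule conjI[OF difference_bounds_swaps(1)[OF D] contrapos_nn[OF U threshold_solvable_swap12]])
  show "difference_bounds r13 r12 r14 r23 r34 r24 c1 c3 c2 c4 d \<and>
      \<not> threshold_solvable r13 r12 r14 r23 r34 r24 c1 c3 c2 c4 d"
    by (rule conjI[OF difference_bounds_swaps(2)[OF D] contrapos_nn[OF U threshold_solvable_swap23]])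
  show "difference_bounds r12 r14 r13 r24 r23 r34 c1 c2 c4 c3 d \<and>
      \<not> threshold_solvable r12 r14 r13 r24 r23 r34 c1 c2 c4 c3 d"
    by (rule conjI[OF difference_bounds_swaps(3)[OF D] contrapos_nn[OF U threshold_solvable_swap34]])
qed

lemma threshold_solvable_if_difference_bounds:
  assumes D: "difference_bounds r12 r13 r14 r23 r24 r34 c1 c2 c3 c4 d"
  shows "threshold_solvable r12 r13 r14 r23 r24 r34 c1 c2 c3 c4 d"
proof (rule ccontr)
  note swap = unsolvable_swaps
  assume "\<not> ?thesis"
  with D have U: "difference_bounds r12 r13 r14 r23 r24 r34 c1 c2 c3 c4 d \<and>
      \<not> threshold_solvable r12 r13 r14 r23 r24 r34 c1 c2 c3 c4 d"
    by simp
  have gap: "0 \<le> r13 + r24 + c1 + c2 + d"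
    if "difference_bounds r12 r13 r14 r23 r24 r34 c1 c2 c3 c4 d \<and>
      \<not> threshold_solvable r12 r13 r14 r23 r24 r34 c1 c2 c3 c4 d"
    for r12 r13 r14 r23 r24 r34 c1 c2 c3 c4
    using that threshold_solvable_if_gap by (meson not_le_imp_less)
  \<comment> \<open>Twelve instances are needed, one for each edge and each perfect matching
    avoiding it; the chain of swaps carries the edge to 12 and the matching to 13, 24.\<close>
  have "threshold_solvable r12 r13 r14 r23 r24 r34 c1 c2 c3 c4 d"
    using
      gap[OF U]
      gap[OF swap(1)[OF U]]
      gap[OF swap(2)[OF swap(3)[OF swap(1)[OF swap(2)[OF U]]]]]
      gap[OF swap(2)[OF swap(3)[OF swap(1)[OF swap(2)[OF swap(1)[OF U]]]]]]
      gap[OF swap(2)[OF U]]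
      gap[OF swap(1)[OF swap(2)[OF U]]]
      gap[OF swap(2)[OF swap(3)[OF swap(1)[OF U]]]]
      gap[OF swap(2)[OF swap(3)[OF swap(2)[OF swap(1)[OF U]]]]]
      gap[OF swap(2)[OF swap(3)[OF U]]]
      gap[OF swap(2)[OF swap(3)[OF swap(2)[OF U]]]]
      gap[OF swap(2)[OF swap(1)[OF U]]]
      gap[OF swap(1)[OF swap(2)[OF swap(1)[OF U]]]]
    by (intro threshold_solvable_if_no_gap[OF D]) linarith+
  then show False using U by simp
qed

section \<open>Inequalities preserved by partial minimization\<close>

text \<open>Summed over the points, a quadratic polynomial depends only on the coordinate sums and
  on the inner products of coordinates. The former agree, and the latter grow against nonpositive
  coefficients.\<close>

lemma quad_poly_sum_le:
  fixes U V :: "nat \<Rightarrow> bool list"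
  assumes b: "\<And>i j. i < j \<Longrightarrow> j < n \<Longrightarrow> b i j \<le> 0"
    and lin: "\<And>i. i < n \<Longrightarrow> (\<Sum>p<m. of_bool (V p ! i) :: real) = (\<Sum>p<m. of_bool (U p ! i))"
    and bil: "\<And>i j. i < n \<Longrightarrow> j < n \<Longrightarrow>
      (\<Sum>p<m. of_bool (U p ! i) * of_bool (U p ! j) :: real) \<le> (\<Sum>p<m. of_bool (V p ! i) * of_bool (V p
          ! j))"
  shows "(\<Sum>p<m. quad_poly n c a b (V p)) \<le> (\<Sum>p<m. quad_poly n c a b (U p))"
proof -
  have expand: "(\<Sum>p<m. quad_poly n c a b (W p)) = m * c + (\<Sum>i<n. a i * (\<Sum>p<m. of_bool (W p ! i)))
      + (\<Sum>j<n. \<Sum>i<j. b i j * (\<Sum>p<m. of_bool (W p ! i) * of_bool (W p ! j)))" for W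
  proof -
    have "(\<Sum>p<m. \<Sum>i<n. a i * of_bool (W p ! i)) = (\<Sum>i<n. a i * (\<Sum>p<m. of_bool (W p ! i)))"
      by (subst sum.swap) (simp only: sum_distrib_left)
    moreover have "(\<Sum>p<m. \<Sum>j<n. \<Sum>i<j. b i j * of_bool (W p ! i) * of_bool (W p ! j))
        = (\<Sum>j<n. \<Sum>p<m. \<Sum>i<j. b i j * of_bool (W p ! i) * of_bool (W p ! j))"
      by (rule sum.swap)
    moreover have "\<dots> = (\<Sum>j<n. \<Sum>i<j. b i j * (\<Sum>p<m. of_bool (W p ! i) * of_bool (W p ! j)))"
      by (rule sum.cong[OF refl], subst sum.swap) (simp only: sum_distrib_left mult.assoc)
    ultimately show ?thesis
      by (simp add: quad_poly_def sum.distrib)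
  qed
  have "(\<Sum>j<n. \<Sum>i<j. b i j * (\<Sum>p<m. of_bool (V p ! i) * of_bool (V p ! j)))
      \<le> (\<Sum>j<n. \<Sum>i<j. b i j * (\<Sum>p<m. of_bool (U p ! i) * of_bool (U p ! j)))"
    by (rule sum_mono, rule sum_mono, rule mult_left_mono_neg[OF bil b]) auto
  moreover have "(\<Sum>i<n. a i * (\<Sum>p<m. of_bool (V p ! i))) = (\<Sum>i<n. a i * (\<Sum>p<m. of_bool (U p ! i)))"
    using lin by (intro sum.cong) auto
  ultimately show ?thesis
    unfolding expand by simp
qed

text \<open>Append to each \<open>X p\<close> a minimizing \<open>z\<close> and apply the operations
  to the full points. The heads of the images are the points on the left, and their tails are
  admissible in the minimum, so an inequality for \<open>h\<close> passes to
  \<open>f\<close>.\<close>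

lemma min_multimorphism:
  fixes h :: "bool list \<Rightarrow> real" and \<phi> :: "nat \<Rightarrow> (nat \<Rightarrow> bool) \<Rightarrow> bool" and X :: "nat \<Rightarrow> bool list"
  assumes h: "submodular_quadratic (n + k) h"
    and count: "\<And>s. (\<Sum>p<m. of_bool (\<phi> p s) :: real) = (\<Sum>p<m. of_bool (s p))"
    and common: "\<And>s t. (\<Sum>p<m. of_bool (s p) * of_bool (t p) :: real) \<le> (\<Sum>p<m. of_bool (\<phi> p s) *
        of_bool (\<phi> p t))"
    and X: "\<And>p. length (X p) = n"
  defines "f \<equiv> \<lambda>x. MIN z\<in>bcube k. h (x @ z)"
  shows "(\<Sum>p<m. f (map (\<lambda>i. \<phi> p (\<lambda>q. X q ! i)) [0..<n])) \<le> (\<Sum>p<m. f (X p))"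
proof -
  obtain c a b where b: "\<forall>j<n + k. \<forall>i<j. b i j \<le> 0"
    and hq: "\<And>v. v \<in> bcube (n + k) \<Longrightarrow> h v = quad_poly (n + k) c a b v"
    using h by (auto simp: submodular_quadratic_def)
  have "\<exists>z\<in>bcube k. f x = h (x @ z)" for x
    unfolding f_def using Min_in[of "(\<lambda>z. h (x @ z)) ` bcube k"] finite_bcube bcube_nonempty by fastforce
  then obtain Z where Z: "\<And>x. Z x \<in> bcube k" "\<And>x. f x = h (x @ Z x)"
    by metis
  define U where "U = (\<lambda>p. X p @ Z (X p))"
  define V where "V = (\<lambda>p. map (\<lambda>i. \<phi> p (\<lambda>q. U q ! i)) [0..<n + k])"
  have split: "V p = map (\<lambda>i. \<phi> p (\<lambda>q. X q ! i)) [0..<n] @ drop n (V p)" for p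
  proof -
    have "take n (V p) = map (\<lambda>i. \<phi> p (\<lambda>q. X q ! i)) [0..<n]"
      using X by (auto simp: V_def U_def take_map nth_append)
    then show ?thesis by (metis append_take_drop_id)
  qed
  have V: "V p \<in> bcube (n + k)" "drop n (V p) \<in> bcube k" for p
    by (simp_all add: V_def bcube_def)
  have U: "U p \<in> bcube (n + k)" for p
    using X Z(1) by (auto simp: U_def bcube_def)
  have "(\<Sum>p<m. f (map (\<lambda>i. \<phi> p (\<lambda>q. X q ! i)) [0..<n])) \<le> (\<Sum>p<m. h (V p))"
  proof (intro sum_mono)
    fix p
    have "f (map (\<lambda>i. \<phi> p (\<lambda>q. X q ! i)) [0..<n]) \<le> h (map (\<lambda>i. \<phi> p (\<lambda>q. X q ! i)) [0..<n] @ drop n (V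
        p))"
      unfolding f_def using V finite_bcube by (intro Min_le) auto
    then show "f (map (\<lambda>i. \<phi> p (\<lambda>q. X q ! i)) [0..<n]) \<le> h (V p)"
      by (simp only: split[symmetric])
  qed
  also have "\<dots> = (\<Sum>p<m. quad_poly (n + k) c a b (V p))"
    using V hq by simp
  also have "\<dots> \<le> (\<Sum>p<m. quad_poly (n + k) c a b (U p))"
  proof (rule quad_poly_sum_le)
    show "b i j \<le> 0" if "i < j" "j < n + k" for i j
      using b that by auto
    show "(\<Sum>p<m. of_bool (V p ! i) :: real) = (\<Sum>p<m. of_bool (U p ! i))" if "i < n + k" for i
      using count[of "\<lambda>q. U q ! i"] that by (simp add: V_def del: sum_of_bool_eq)
    show "(\<Sum>p<m. of_bool (U p ! i) * of_bool (U p ! j) :: real) \<le> (\<Sum>p<m. of_bool (V p ! i) * of_bool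
        (V p ! j))"
      if "i < n + k" "j < n + k" for i j
      using common[of "\<lambda>q. U q ! i" "\<lambda>q. U q ! j"] that by (simp add: V_def del: sum_of_bool_eq)
  qed
  also have "\<dots> = (\<Sum>p<m. h (U p))"
    using U hq by simp
  also have "\<dots> = (\<Sum>p<m. f (X p))"
    using Z(2) by (simp add: U_def)
  finally show ?thesis .
qed

text \<open>
  Applied to the points with supports 13, 14, 23, 24, 34 (in this order), the five
  operations return the points with supports 134, 234, 12, 3, 4; their values elsewhere
  are chosen to satisfy \<open>join_five_count\<close> and \<open>join_five_common\<close>.
\<close>

definition join_five :: "nat \<Rightarrow> (nat \<Rightarrow> bool) \<Rightarrow> bool" where
  "join_five p s =
    (if p = 0 then s 0 \<or> s 1 \<or> s 4
     else if p = 1 then s 2 \<or> s 3 \<or> s 4 \<and> (s 0 \<or> s 1)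
     else if p = 2 then s 0 \<and> s 1 \<or> s 2 \<and> s 3 \<or> s 0 \<and> s 3 \<and> s 4 \<or> s 1 \<and> s 2 \<and> s 4
     else if p = 3 then s 0 \<and> s 2 \<and> s 4 \<or> s 0 \<and> s 1 \<and> s 2 \<and> s 3
     else s 1 \<and> s 3 \<and> s 4)"

lemma sum_lessThan_5: "(\<Sum>p<5. g p) = g 0 + g 1 + g 2 + g 3 + g (4::nat)"
  for g :: "nat \<Rightarrow> 'a::comm_monoid_add"
  by (simp add: eval_nat_numeral add.assoc)

lemma join_five_count: "(\<Sum>p<5. of_bool (join_five p s) :: real) = (\<Sum>p<5. of_bool (s p))"
  unfolding sum_lessThan_5
  by (cases "s 0"; cases "s 1"; cases "s 2"; cases "s 3"; cases "s 4"; simp add: join_five_def)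

lemma join_five_common: "(\<Sum>p<5. of_bool (s p) * of_bool (t p) :: real)
    \<le> (\<Sum>p<5. of_bool (join_five p s) * of_bool (join_five p t))"
  unfolding sum_lessThan_5
  by (cases "s 0"; cases "s 1"; cases "s 2"; cases "s 3"; cases "s 4";
      cases "t 0"; cases "t 1"; cases "t 2"; cases "t 3"; cases "t 4"; simp add: join_five_def)

text \<open>Meet and join form the operation on two points with the required counts and inner
  products.\<close>

lemma min_submodular:
  fixes h :: "bool list \<Rightarrow> real"
  assumes h: "submodular_quadratic (n + k) h" and xy: "length x = n" "length y = n"
  defines "f \<equiv> \<lambda>x. MIN z\<in>bcube k. h (x @ z)"
  shows "f (map2 (\<and>) x y) + f (map2 (\<or>) x y) \<le> f x + f y"
proof -
  define \<phi> where "\<phi> p s = (if p = 0 then s 0 \<and> s 1 else s 0 \<or> s 1)" for p :: nat and s :: "nat \<Rightarrow> bool"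
  have two: "(\<Sum>p<2::nat. g p) = g 0 + g (1::nat)" for g :: "nat \<Rightarrow> real"
    by (simp add: eval_nat_numeral)
  have "(\<Sum>p<2::nat. f (map (\<lambda>i. \<phi> p (\<lambda>q. (if q = 0 then x else y) ! i)) [0..<n]))
      \<le> (\<Sum>p<2::nat. f (if p = 0 then x else y))"
    unfolding f_def
    by (rule min_multimorphism[OF h, where m = 2 and \<phi> = \<phi> and X = "\<lambda>q. if q = 0 then x else y"])
      (auto simp only: two \<phi>_def xy, auto simp: xy)
  moreover have "map (\<lambda>i. \<phi> 0 (\<lambda>q. (if q = 0 then x else y) ! i)) [0..<n] = map2 (\<and>) x y"
    "map (\<lambda>i. \<phi> 1 (\<lambda>q. (if q = 0 then x else y) ! i)) [0..<n] = map2 (\<or>) x y"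
    using xy by (auto simp: \<phi>_def intro!: nth_equalityI)
  ultimately show ?thesis by (simp add: two)
qed

text \<open>The first 24 inequalities are second differences, one for each pair of coordinates and
  each fixing of the other two. The last six come from the relabellings of
  \<open>join_five\<close>.\<close>

lemma difference_bounds_min:
  fixes h :: "bool list \<Rightarrow> real"
  assumes h: "submodular_quadratic (4 + k) h"
    and poly: "\<And>x1 x2 x3 x4. (MIN z\<in>bcube k. h ([x1, x2, x3, x4] @ z)) =
      c0 + a1 * of_bool x1 + a2 * of_bool x2 + a3 * of_bool x3 + a4 * of_bool x4
      - (r34 * of_bool (x1 \<and> x2) + r24 * of_bool (x1 \<and> x3) + r23 * of_bool (x1 \<and> x4)
        + r14 * of_bool (x2 \<and> x3) + r13 * of_bool (x2 \<and> x4) + r12 * of_bool (x3 \<and> x4)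
        + c4 * of_bool (x1 \<and> x2 \<and> x3) + c3 * of_bool (x1 \<and> x2 \<and> x4)
        + c2 * of_bool (x1 \<and> x3 \<and> x4) + c1 * of_bool (x2 \<and> x3 \<and> x4)
        + d * of_bool (x1 \<and> x2 \<and> x3 \<and> x4))"
  shows "difference_bounds r12 r13 r14 r23 r24 r34 c1 c2 c3 c4 d"
proof -
  define f where "f = (\<lambda>x. MIN z\<in>bcube k. h (x @ z))"
  have f: "f [x1, x2, x3, x4] =
      c0 + a1 * of_bool x1 + a2 * of_bool x2 + a3 * of_bool x3 + a4 * of_bool x4
      - (r34 * of_bool (x1 \<and> x2) + r24 * of_bool (x1 \<and> x3) + r23 * of_bool (x1 \<and> x4)
        + r14 * of_bool (x2 \<and> x3) + r13 * of_bool (x2 \<and> x4) + r12 * of_bool (x3 \<and> x4)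
        + c4 * of_bool (x1 \<and> x2 \<and> x3) + c3 * of_bool (x1 \<and> x2 \<and> x4)
        + c2 * of_bool (x1 \<and> x3 \<and> x4) + c1 * of_bool (x2 \<and> x3 \<and> x4)
        + d * of_bool (x1 \<and> x2 \<and> x3 \<and> x4))" for x1 x2 x3 x4
    unfolding f_def by (rule poly)
  have sub: "f (map2 (\<and>) x y) + f (map2 (\<or>) x y) \<le> f x + f y" if "length x = 4" "length y = 4" for x y
    unfolding f_def by (rule min_submodular[OF h that])
  have five: "f (P 0) + f (P 1) + f (P 2) + f (P 3) + f (P 4) \<le> f (X 0) + f (X 1) + f (X 2) + f (X 3)
      + f (X 4)"
    if "\<And>p. length (X p) = 4" and "P = (\<lambda>p. map (\<lambda>i. join_five p (\<lambda>q. X q ! i)) [0..<4])" for P X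
    using min_multimorphism[OF h join_five_count join_five_common that(1)]
    by (simp only: that(2) sum_lessThan_5 f_def)
  have s12: "f [False, False, x, y] + f [True, True, x, y] \<le> f [True, False, x, y]
      + f [False, True, x, y]" for x y
    using sub[of "[True, False, x, y]" "[False, True, x, y]"] by simp
  have s13: "f [False, x, False, y] + f [True, x, True, y] \<le> f [True, x, False, y]
      + f [False, x, True, y]" for x y
    using sub[of "[True, x, False, y]" "[False, x, True, y]"] by simp
  have s14: "f [False, x, y, False] + f [True, x, y, True] \<le> f [True, x, y, False]
      + f [False, x, y, True]" for x y
    using sub[of "[True, x, y, False]" "[False, x, y, True]"] by simp
  have s23: "f [x, False, False, y] + f [x, True, True, y] \<le> f [x, True, False, y]
      + f [x, False, True, y]" for x y
    using sub[of "[x, True, False, y]" "[x, False, True, y]"] by simp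
  have s24: "f [x, False, y, False] + f [x, True, y, True] \<le> f [x, True, y, False]
      + f [x, False, y, True]" for x y
    using sub[of "[x, True, y, False]" "[x, False, y, True]"] by simp
  have s34: "f [x, y, False, False] + f [x, y, True, True] \<le> f [x, y, True, False]
      + f [x, y, False, True]" for x y
    using sub[of "[x, y, True, False]" "[x, y, False, True]"] by simp
  \<comment> \<open>Expanding \<open>f\<close> here leaves \<open>r12 + r34 + c1 + c2 >= 0\<close>;
    the next five facts yield the analogous inequalities for the other pairs.\<close>
  have f12: "f [True, False, True, True] + f [False, True, True, True] + f [True, True, False, False]
      + f [False, False, True, False] + f [False, False, False, True]
      \<le> f [True, False, True, False] + f [True, False, False, True] + f [False, True, True, False]
          + f [False, True, False, True] + f [False, False, True, True]"
    using five[of "\<lambda>q. if q = 0 then [True, False, True, False] else if q = 1 then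
        [True, False, False, True] else if q = 2 then [False, True, True, False] else if q = 3 then
        [False, True, False, True] else [False, False, True, True]", OF _ refl]
    by (simp add: join_five_def upt_rec)
  have f13: "f [True, True, False, True] + f [False, True, True, True] + f [True, False, True, False]
      + f [False, True, False, False] + f [False, False, False, True]
      \<le> f [True, True, False, False] + f [True, False, False, True] + f [False, True, True, False]
          + f [False, False, True, True] + f [False, True, False, True]"
    using five[of "\<lambda>q. if q = 0 then [True, True, False, False] else if q = 1 then
        [True, False, False, True] else if q = 2 then [False, True, True, False] else if q = 3 then
        [False, False, True, True] else [False, True, False, True]", OF _ refl]
    by (simp add: join_five_def upt_rec)
  have f14: "f [True, True, True, False] + f [False, True, True, True] + f [True, False, False, True]
      + f [False, True, False, False] + f [False, False, True, False]
      \<le> f [True, True, False, False] + f [True, False, True, False] + f [False, True, False, True]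
          + f [False, False, True, True] + f [False, True, True, False]"
    using five[of "\<lambda>q. if q = 0 then [True, True, False, False] else if q = 1 then
        [True, False, True, False] else if q = 2 then [False, True, False, True] else if q = 3 then
        [False, False, True, True] else [False, True, True, False]", OF _ refl]
    by (simp add: join_five_def upt_rec)
  have f23: "f [True, True, False, True] + f [True, False, True, True] + f [False, True, True, False]
      + f [True, False, False, False] + f [False, False, False, True]
      \<le> f [True, True, False, False] + f [False, True, False, True] + f [True, False, True, False]
          + f [False, False, True, True] + f [True, False, False, True]"
    using five[of "\<lambda>q. if q = 0 then [True, True, False, False] else if q = 1 then
        [False, True, False, True] else if q = 2 then [True, False, True, False] else if q = 3 then
        [False, False, True, True] else [True, False, False, True]", OF _ refl]
    by (simp add: join_five_def upt_rec)
  have f24: "f [True, True, True, False] + f [True, False, True, True] + f [False, True, False, True]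
      + f [True, False, False, False] + f [False, False, True, False]
      \<le> f [True, True, False, False] + f [False, True, True, False] + f [True, False, False, True]
          + f [False, False, True, True] + f [True, False, True, False]"
    using five[of "\<lambda>q. if q = 0 then [True, True, False, False] else if q = 1 then
        [False, True, True, False] else if q = 2 then [True, False, False, True] else if q = 3 then
        [False, False, True, True] else [True, False, True, False]", OF _ refl]
    by (simp add: join_five_def upt_rec)
  have f34: "f [True, True, True, False] + f [True, True, False, True] + f [False, False, True, True]
      + f [True, False, False, False] + f [False, True, False, False]
      \<le> f [True, False, True, False] + f [False, True, True, False] + f [True, False, False, True]
          + f [False, True, False, True] + f [True, True, False, False]"
    using five[of "\<lambda>q. if q = 0 then [True, False, True, False] else if q = 1 then
        [False, True, True, False] else if q = 2 then [True, False, False, True] else if q = 3 then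
        [False, True, False, True] else [True, True, False, False]", OF _ refl]
    by (simp add: join_five_def upt_rec)
  note ineqs = s12[of False False] s12[of False True] s12[of True False] s12[of True True]
      s13[of False False] s13[of False True] s13[of True False] s13[of True True]
      s14[of False False] s14[of False True] s14[of True False] s14[of True True]
      s23[of False False] s23[of False True] s23[of True False] s23[of True True]
      s24[of False False] s24[of False True] s24[of True False] s24[of True True]
      s34[of False False] s34[of False True] s34[of True False] s34[of True True]
      f12 f13 f14 f23
      f24 f34
  show ?thesis
    unfolding difference_bounds_def using ineqs[unfolded f, simplified] by (intro conjI; linarith)
qed

section \<open>Two auxiliary variables\<close>

lemma quad_poly_6:
  "quad_poly 6 c a b [x1, x2, x3, x4, x5, x6] =
    c + a 0 * of_bool x1 + a 1 * of_bool x2 + a 2 * of_bool x3 + a 3 * of_bool x4 + a 4 * of_bool x5 +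
        a 5 * of_bool x6
    + b 0 1 * of_bool (x1 \<and> x2) + b 0 2 * of_bool (x1 \<and> x3) + b 0 3 * of_bool (x1 \<and> x4)
    + b 0 4 * of_bool (x1 \<and> x5) + b 0 5 * of_bool (x1 \<and> x6) + b 1 2 * of_bool (x2 \<and> x3)
    + b 1 3 * of_bool (x2 \<and> x4) + b 1 4 * of_bool (x2 \<and> x5) + b 1 5 * of_bool (x2 \<and> x6)
    + b 2 3 * of_bool (x3 \<and> x4) + b 2 4 * of_bool (x3 \<and> x5) + b 2 5 * of_bool (x3 \<and> x6)
    + b 3 4 * of_bool (x4 \<and> x5) + b 3 5 * of_bool (x4 \<and> x6) + b 4 5 * of_bool (x5 \<and> x6)"
  by (simp add: quad_poly_def eval_nat_numeral lessThan_Suc algebra_simps)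

text \<open>The second auxiliary variable is switched on only together with the first, so attainment
  at \<open>[False, True]\<close> is not offered.\<close>

lemma MIN_bcube_2_eqI:
  fixes v :: real
  assumes "v \<le> g [False, False]" "v \<le> g [True, False]" "v \<le> g [False, True]" "v \<le> g [True, True]"
    and "g [False, False] = v \<or> g [True, False] = v \<or> g [True, True] = v"
  shows "(MIN z\<in>bcube 2. g z) = v"
proof (rule Min_eqI)
  have cube: "bcube 2 = {[False, False], [True, False], [False, True], [True, True]}"
    by (auto simp: bcube_def length_Suc_conv eval_nat_numeral)
  show "finite (g ` bcube 2)"
    by (simp add: finite_bcube)
  show "v \<le> y" if "y \<in> g ` bcube 2" for y
    using that assms(1-4) by (auto simp: cube)
  show "v \<in> g ` bcube 2"
    using assms(5) by (auto simp: cube)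
qed

lemma two_auxiliaries_if_threshold_solvable:
  fixes f :: "bool list \<Rightarrow> real"
  assumes solvable: "threshold_solvable r12 r13 r14 r23 r24 r34 c1 c2 c3 c4 d"
    and poly: "\<And>x1 x2 x3 x4. f [x1, x2, x3, x4] =
      c0 + a1 * of_bool x1 + a2 * of_bool x2 + a3 * of_bool x3 + a4 * of_bool x4
      - (r34 * of_bool (x1 \<and> x2) + r24 * of_bool (x1 \<and> x3) + r23 * of_bool (x1 \<and> x4)
        + r14 * of_bool (x2 \<and> x3) + r13 * of_bool (x2 \<and> x4) + r12 * of_bool (x3 \<and> x4)
        + c4 * of_bool (x1 \<and> x2 \<and> x3) + c3 * of_bool (x1 \<and> x2 \<and> x4)
        + c2 * of_bool (x1 \<and> x3 \<and> x4) + c1 * of_bool (x2 \<and> x3 \<and> x4)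
        + d * of_bool (x1 \<and> x2 \<and> x3 \<and> x4))"
  shows "\<exists>h' :: bool list \<Rightarrow> real. submodular_quadratic (4 + 2) h' \<and>
    (\<forall>x\<in>bcube 4. (MIN z\<in>bcube 2. h' (x @ z)) = f x)"
proof -
  obtain s1 s2 s3 s4 h m12 m13 m14 m23 m24 m34 e1 e2 e3 e4 E where
    parts: "opposite_positive_parts s1 s2 s3 s4 m12 m13 m14 m23 m24 m34"
    and vals: "threshold_values c1 c2 c3 c4 d s1 s2 s3 s4 h m12 m13 m14 m23 m24 m34 e1 e2 e3 e4 E"
    and sys: "threshold_system r12 r13 r14 r23 r24 r34 s1 s2 s3 s4 h m12 m13 m14 m23 m24 m34 e1 e2 e3 e4 E"
    using solvable unfolding threshold_solvable_def by blast
  have m: "0 \<le> m12" "0 \<le> m13" "0 \<le> m14" "0 \<le> m23" "0 \<le> m24" "0 \<le> m34"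
      "s3 + s4 \<le> m12" "s2 + s4 \<le> m13" "s2 + s3 \<le> m14" "s1 + s4 \<le> m23" "s1 + s3 \<le> m24" "s1 + s2 \<le> m34"
    and m_cases: "m12 = 0 \<or> m12 = s3 + s4" "m13 = 0 \<or> m13 = s2 + s4" "m14 = 0 \<or> m14 = s2 + s3"
        "m23 = 0 \<or> m23 = s1 + s4" "m24 = 0 \<or> m24 = s1 + s3" "m34 = 0 \<or> m34 = s1 + s2"
    using parts by (auto simp: opposite_positive_parts_def)
  have e1: "e1 = c1 + m23 + m24 + m34 + h - (s1 + s1 + s2 + s3 + s4)"
    and e2: "e2 = c2 + m13 + m14 + m34 + h - (s2 + s1 + s2 + s3 + s4)"
    and e3: "e3 = c3 + m12 + m14 + m24 + h - (s3 + s1 + s2 + s3 + s4)"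
    and e4: "e4 = c4 + m12 + m13 + m23 + h - (s4 + s1 + s2 + s3 + s4)"
    using vals unfolding threshold_values_def by blast+
  have E: "E = c1 + c2 + c3 + c4 + d + m12 + m13 + m14 + m23 + m24 + m34 + 2 * h - 2 * s1 - 2 * s2 - 2
      * s3 - 2 * s4"
    using vals by (simp add: threshold_values_def)
  note sys = sys[unfolded threshold_system_def]
  \<comment> \<open>\<open>mr\<close>, \<open>hw\<close> and \<open>e_le\<close> make bilinear
    coefficients nonpositive. \<open>hs\<close> and \<open>hL\<close> give the factor of
    \<open>z1\<close> its sign at weights 1 and 3. With \<open>z1\<close> on, \<open>e_sum\<close>
    keeps \<open>z2\<close> off at weight 1 and \<open>e_nonneg\<close> turns it on at weight 3;
    \<open>e_pair\<close> bounds the joint contribution at weight 2.\<close>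
  have mr: "m34 \<le> r12" "m24 \<le> r13" "m23 \<le> r14" "m14 \<le> r23" "m13 \<le> r24" "m12 \<le> r34"
    and hs: "h \<le> s1" "h \<le> s2" "h \<le> s3" "h \<le> s4"
    and hw: "h \<le> s2 + s3 + s4" "h \<le> s1 + s3 + s4" "h \<le> s1 + s2 + s4" "h \<le> s1 + s2 + s3"
    and hL: "h \<le> s1 + s1 + s2 + s3 + s4" "h \<le> s2 + s1 + s2 + s3 + s4" "h \<le> s3 + s1 + s2 + s3 + s4"
        "h \<le> s4 + s1 + s2 + s3 + s4"
    and e_nonneg: "0 \<le> e1" "0 \<le> e2" "0 \<le> e3" "0 \<le> e4"
    and e_le: "e1 \<le> E" "e2 \<le> E" "e3 \<le> E" "e4 \<le> E"
    and e_pair: "e1 + e2 - E \<le> m34 - (s1 + s2)" "e1 + e3 - E \<le> m24 - (s1 + s3)"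
        "e1 + e4 - E \<le> m23 - (s1 + s4)" "e2 + e3 - E \<le> m14 - (s2 + s3)" "e2 + e4 - E \<le> m13 - (s2 + s4)"
        "e3 + e4 - E \<le> m12 - (s3 + s4)"
    and e_sum: "e2 + e3 + e4 \<le> 2 * E" "e1 + e3 + e4 \<le> 2 * E" "e1 + e2 + e4 \<le> 2 * E"
        "e1 + e2 + e3 \<le> 2 * E"
    using sys by (simp_all only: simp_thms)
  \<comment> \<open>Summing \<open>hs\<close> and \<open>hL\<close> over the four indices bounds
    \<open>4 * h\<close> by the sum of the \<open>si\<close> and by five times it. The result is for
    the point of weight 4, where the factor of \<open>z1\<close> is twice the difference.\<close>
  have hS: "h \<le> s1 + s2 + s3 + s4"
    using hs hL by linarith
  define t where "t = s1 + s2 + s3 + s4 - 2 * h"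
  define u where "u = 4 * E - (e1 + e2 + e3 + e4)"
  define a where "a = (!) [a1, a2, a3, a4, t, u]"
  \<comment> \<open>The coefficient of \<open>xi xj\<close> is that of \<open>f\<close> raised by
    \<open>mij\<close>, which compensates the contribution \<open>- mij\<close> of the auxiliary
    terms at the point with support \<open>{i,j}\<close>.\<close>
  define b where "b = (\<lambda>i j. [
    [0, - (r34 - m12), - (r24 - m13), - (r23 - m14), h - (s1 + s2 + s3 + s4 - s1), e1 - E],
    [0, 0, - (r14 - m23), - (r13 - m24), h - (s1 + s2 + s3 + s4 - s2), e2 - E],
    [0, 0, 0, - (r12 - m34), h - (s1 + s2 + s3 + s4 - s3), e3 - E],
    [0, 0, 0, 0, h - (s1 + s2 + s3 + s4 - s4), e4 - E],
    [0, 0, 0, 0, 0, - E]] ! i ! j)"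
  define h' where "h' = quad_poly 6 c0 a b"
  have "0 \<le> E" and hw': "h - (s1 + s2 + s3 + s4 - s1) \<le> 0" "h - (s1 + s2 + s3 + s4 - s2) \<le> 0"
      "h - (s1 + s2 + s3 + s4 - s3) \<le> 0" "h - (s1 + s2 + s3 + s4 - s4) \<le> 0"
    using hw e_nonneg(1) e_le(1) by linarith+
  then have nonpos: "\<forall>j<6. \<forall>i<j. b i j \<le> 0"
    using mr e_le by (simp add: eval_nat_numeral All_less_Suc b_def)
  have h': "h' [x1, x2, x3, x4, z1, z2] =
      c0 + a1 * of_bool x1 + a2 * of_bool x2 + a3 * of_bool x3 + a4 * of_bool x4
      - ((r34 - m12) * of_bool (x1 \<and> x2) + (r24 - m13) * of_bool (x1 \<and> x3) + (r23 - m14) * of_bool (x1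
          \<and> x4) + (r14 - m23) * of_bool (x2 \<and> x3) + (r13 - m24) * of_bool (x2 \<and> x4) + (r12 - m34) *
          of_bool (x3 \<and> x4))
      + of_bool z1 * (t - ((s1 + s2 + s3 + s4 - s1 - h) * of_bool x1 + (s1 + s2 + s3 + s4 - s2 - h) *
          of_bool x2 + (s1 + s2 + s3 + s4 - s3 - h) * of_bool x3 + (s1 + s2 + s3 + s4 - s4 - h) * of_bool
          x4))
      + of_bool z2 * (u - ((E - e1) * of_bool x1 + (E - e2) * of_bool x2 + (E - e3) * of_bool x3 + (E
          - e4) * of_bool x4))
      - E * of_bool (z1 \<and> z2)" for x1 x2 x3 x4 z1 z2
    unfolding h'_def quad_poly_6 by (simp add: a_def b_def algebra_simps)
  \<comment> \<open>The sixteen points are numbered in binary with the first coordinate least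
    significant. The minimum is attained with both auxiliary variables off at weights 0 and 1 and at
    gaps, with only the first on at the other points of weight 2, and with both on at weights 3 and
    4.\<close>
  have x0: "(MIN z\<in>bcube 2. h' ([False, False, False, False] @ z)) = f [False, False, False, False]"
    by (rule MIN_bcube_2_eqI; simp only: append.simps h' poly t_def u_def of_bool_eq simp_thms
        mult_1_right mult_zero_right mult_1_left mult_zero_left; use e_le e_sum hs hw in linarith)
  have x1: "(MIN z\<in>bcube 2. h' ([True, False, False, False] @ z)) = f [True, False, False, False]"
    by (rule MIN_bcube_2_eqI; simp only: append.simps h' poly t_def u_def of_bool_eq simp_thms
        mult_1_right mult_zero_right mult_1_left mult_zero_left; use e_le e_sum hs hw e_nonneg in
        linarith)
  have x2: "(MIN z\<in>bcube 2. h' ([False, True, False, False] @ z)) = f [False, True, False, False]"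
    by (rule MIN_bcube_2_eqI; simp only: append.simps h' poly t_def u_def of_bool_eq simp_thms
        mult_1_right mult_zero_right mult_1_left mult_zero_left; use e_le e_sum hs hw e_nonneg in
        linarith)
  have x3: "(MIN z\<in>bcube 2. h' ([True, True, False, False] @ z)) = f [True, True, False, False]"
    by (rule MIN_bcube_2_eqI; simp only: append.simps h' poly t_def u_def of_bool_eq simp_thms
        mult_1_right mult_zero_right mult_1_left mult_zero_left; use m(1) m(7) m_cases(1) e_le e_nonneg
        e_pair(6) in linarith)
  have x4: "(MIN z\<in>bcube 2. h' ([False, False, True, False] @ z)) = f [False, False, True, False]"
    by (rule MIN_bcube_2_eqI; simp only: append.simps h' poly t_def u_def of_bool_eq simp_thms
        mult_1_right mult_zero_right mult_1_left mult_zero_left; use e_le e_sum hs hw e_nonneg in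
        linarith)
  have x5: "(MIN z\<in>bcube 2. h' ([True, False, True, False] @ z)) = f [True, False, True, False]"
    by (rule MIN_bcube_2_eqI; simp only: append.simps h' poly t_def u_def of_bool_eq simp_thms
        mult_1_right mult_zero_right mult_1_left mult_zero_left; use m(2) m(8) m_cases(2) e_le e_nonneg
        e_pair(5) in linarith)
  have x6: "(MIN z\<in>bcube 2. h' ([False, True, True, False] @ z)) = f [False, True, True, False]"
    by (rule MIN_bcube_2_eqI; simp only: append.simps h' poly t_def u_def of_bool_eq simp_thms
        mult_1_right mult_zero_right mult_1_left mult_zero_left; use m(4) m(10) m_cases(4) e_le e_nonneg
        e_pair(3) in linarith)
  have x7: "(MIN z\<in>bcube 2. h' ([True, True, True, False] @ z)) = f [True, True, True, False]"
    by (rule MIN_bcube_2_eqI; simp only: append.simps h' poly t_def u_def of_bool_eq simp_thms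
        mult_1_right mult_zero_right mult_1_left mult_zero_left; use e4 hL(4) e_nonneg e_le in linarith)
  have x8: "(MIN z\<in>bcube 2. h' ([False, False, False, True] @ z)) = f [False, False, False, True]"
    by (rule MIN_bcube_2_eqI; simp only: append.simps h' poly t_def u_def of_bool_eq simp_thms
        mult_1_right mult_zero_right mult_1_left mult_zero_left; use e_le e_sum hs hw e_nonneg in
        linarith)
  have x9: "(MIN z\<in>bcube 2. h' ([True, False, False, True] @ z)) = f [True, False, False, True]"
    by (rule MIN_bcube_2_eqI; simp only: append.simps h' poly t_def u_def of_bool_eq simp_thms
        mult_1_right mult_zero_right mult_1_left mult_zero_left; use m(3) m(9) m_cases(3) e_le e_nonneg
        e_pair(4) in linarith)
  have x10: "(MIN z\<in>bcube 2. h' ([False, True, False, True] @ z)) = f [False, True, False, True]"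
    by (rule MIN_bcube_2_eqI; simp only: append.simps h' poly t_def u_def of_bool_eq simp_thms
        mult_1_right mult_zero_right mult_1_left mult_zero_left; use m(5) m(11) m_cases(5) e_le e_nonneg
        e_pair(2) in linarith)
  have x11: "(MIN z\<in>bcube 2. h' ([True, True, False, True] @ z)) = f [True, True, False, True]"
    by (rule MIN_bcube_2_eqI; simp only: append.simps h' poly t_def u_def of_bool_eq simp_thms
        mult_1_right mult_zero_right mult_1_left mult_zero_left; use e3 hL(3) e_nonneg e_le in linarith)
  have x12: "(MIN z\<in>bcube 2. h' ([False, False, True, True] @ z)) = f [False, False, True, True]"
    by (rule MIN_bcube_2_eqI; simp only: append.simps h' poly t_def u_def of_bool_eq simp_thms
        mult_1_right mult_zero_right mult_1_left mult_zero_left; use m(6) m(12) m_cases(6) e_le e_nonneg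
        e_pair(1) in linarith)
  have x13: "(MIN z\<in>bcube 2. h' ([True, False, True, True] @ z)) = f [True, False, True, True]"
    by (rule MIN_bcube_2_eqI; simp only: append.simps h' poly t_def u_def of_bool_eq simp_thms
        mult_1_right mult_zero_right mult_1_left mult_zero_left; use e2 hL(2) e_nonneg e_le in linarith)
  have x14: "(MIN z\<in>bcube 2. h' ([False, True, True, True] @ z)) = f [False, True, True, True]"
    by (rule MIN_bcube_2_eqI; simp only: append.simps h' poly t_def u_def of_bool_eq simp_thms
        mult_1_right mult_zero_right mult_1_left mult_zero_left; use e1 hL(1) e_nonneg e_le in linarith)
  have x15: "(MIN z\<in>bcube 2. h' ([True, True, True, True] @ z)) = f [True, True, True, True]"
    by (rule MIN_bcube_2_eqI; simp only: append.simps h' poly t_def u_def of_bool_eq simp_thms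
        mult_1_right mult_zero_right mult_1_left mult_zero_left; use E hS e_nonneg(1) e_le(1) in linarith)
  have "(MIN z\<in>bcube 2. h' (x @ z)) = f x" if x: "x \<in> bcube 4" for x
  proof -
    obtain x1 x2 x3 x4 where "x = [x1, x2, x3, x4]"
      using x by (auto simp: bcube_def length_Suc_conv eval_nat_numeral)
    then show ?thesis
      by (cases x1; cases x2; cases x3; cases x4) (simp_all only: x0 x1 x2 x3 x4 x5 x6 x7 x8 x9 x10
          x11 x12 x13 x14 x15)
  qed
  moreover have "submodular_quadratic (4 + 2) h'"
    unfolding submodular_quadratic_def h'_def using nonpos by (intro exI[of _ c0] exI[of _ a] exI[of _ b]) simp
  ultimately show ?thesis by blast
qed

theorem theorem4:
  fixes k :: nat and h :: "bool list \<Rightarrow> real"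
  assumes "submodular_quadratic (4 + k) h"
  shows "\<exists>h' :: bool list \<Rightarrow> real. submodular_quadratic (4 + 2) h' \<and>
    (\<forall>x\<in>bcube 4. (MIN z\<in>bcube 2. h' (x @ z)) = (MIN z\<in>bcube k. h (x @ z)))"
proof -
  define f where "f = (\<lambda>x. MIN z\<in>bcube k. h (x @ z))"
  \<comment> \<open>The coefficients of the multilinear polynomial come from Moebius inversion over
    subsets of the support. From degree 2 on the sign is reversed, and at degrees 2 and 3 the
    indices name the complementary variables.\<close>
  define c0 where "c0 = f [False, False, False, False]"
  define a1 where "a1 = f [True, False, False, False] - f [False, False, False, False]"
  define a2 where "a2 = f [False, True, False, False] - f [False, False, False, False]"
  define a3 where "a3 = f [False, False, True, False] - f [False, False, False, False]"
  define a4 where "a4 = f [False, False, False, True] - f [False, False, False, False]"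
  define r34 where "r34 = - (f [True, True, False, False] - f [True, False, False, False] -
      f [False, True, False, False] + f [False, False, False, False])"
  define r24 where "r24 = - (f [True, False, True, False] - f [True, False, False, False] -
      f [False, False, True, False] + f [False, False, False, False])"
  define r23 where "r23 = - (f [True, False, False, True] - f [True, False, False, False] -
      f [False, False, False, True] + f [False, False, False, False])"
  define r14 where "r14 = - (f [False, True, True, False] - f [False, True, False, False] -
      f [False, False, True, False] + f [False, False, False, False])"
  define r13 where "r13 = - (f [False, True, False, True] - f [False, True, False, False] -
      f [False, False, False, True] + f [False, False, False, False])"
  define r12 where "r12 = - (f [False, False, True, True] - f [False, False, True, False] -
      f [False, False, False, True] + f [False, False, False, False])"
  define c4 where "c4 = - (f [True, True, True, False] - f [True, True, False, False] -
      f [True, False, True, False] - f [False, True, True, False] + f [True, False, False, False]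
      + f [False, True, False, False] + f [False, False, True, False] - f [False, False, False, False])"
  define c3 where "c3 = - (f [True, True, False, True] - f [True, True, False, False] -
      f [True, False, False, True] - f [False, True, False, True] + f [True, False, False, False]
      + f [False, True, False, False] + f [False, False, False, True] - f [False, False, False, False])"
  define c2 where "c2 = - (f [True, False, True, True] - f [True, False, True, False] -
      f [True, False, False, True] - f [False, False, True, True] + f [True, False, False, False]
      + f [False, False, True, False] + f [False, False, False, True] - f [False, False, False, False])"
  define c1 where "c1 = - (f [False, True, True, True] - f [False, True, True, False] -
      f [False, True, False, True] - f [False, False, True, True] + f [False, True, False, False]
      + f [False, False, True, False] + f [False, False, False, True] - f [False, False, False, False])"
  define d where "d = - (f [True, True, True, True] - f [True, True, True, False] -
      f [True, True, False, True] - f [True, False, True, True] - f [False, True, True, True]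
      + f [True, True, False, False] + f [True, False, True, False] + f [True, False, False, True]
      + f [False, True, True, False] + f [False, True, False, True] + f [False, False, True, True] -
      f [True, False, False, False] - f [False, True, False, False] - f [False, False, True, False] -
      f [False, False, False, True] + f [False, False, False, False])"
  have poly: "f [x1, x2, x3, x4] =
      c0 + a1 * of_bool x1 + a2 * of_bool x2 + a3 * of_bool x3 + a4 * of_bool x4
      - (r34 * of_bool (x1 \<and> x2) + r24 * of_bool (x1 \<and> x3) + r23 * of_bool (x1 \<and> x4)
        + r14 * of_bool (x2 \<and> x3) + r13 * of_bool (x2 \<and> x4) + r12 * of_bool (x3 \<and> x4)
        + c4 * of_bool (x1 \<and> x2 \<and> x3) + c3 * of_bool (x1 \<and> x2 \<and> x4)
        + c2 * of_bool (x1 \<and> x3 \<and> x4) + c1 * of_bool (x2 \<and> x3 \<and> x4)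
        + d * of_bool (x1 \<and> x2 \<and> x3 \<and> x4))" for x1 x2 x3 x4
    by (cases x1; cases x2; cases x3; cases x4)
      (simp_all add: c0_def a1_def a2_def a3_def a4_def r34_def r24_def r23_def r14_def r13_def
          r12_def c4_def c3_def c2_def c1_def d_def)
  have "difference_bounds r12 r13 r14 r23 r24 r34 c1 c2 c3 c4 d"
    using difference_bounds_min[OF assms poly[unfolded f_def]] .
  then have "threshold_solvable r12 r13 r14 r23 r24 r34 c1 c2 c3 c4 d"
    by (rule threshold_solvable_if_difference_bounds)
  from two_auxiliaries_if_threshold_solvable[OF this poly] show ?thesis
    unfolding f_def .
qed

end
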